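(* There is a constant $C$, independent of $u_0$, such that for every $u_0\in bmo(\mathbb{R}^d)$ the heat equation $\partial_t u-\Delta u=0$ in $\mathbb{R}^d\times[0,\infty)$ with $u(0)=u_0$ has a solution $u(t)$ satisfying $$\sup_{t>0}\left(\|u(t)\|_{bmo}+t^{1/2}\|\nabla u(t)\|_{L^\infty}+t\|\nabla^2u(t)\|_{L^\infty}+t\|\partial_tu(t)\|_{L^\infty}\right)\le C\|u_0\|_{bmo}.$$
   Context: $bmo(\mathbb{R}^d)$ is the local $BMO$ space of locally integrable $h$ with $\|h\|_{bmo}=\sup_{|Q|\le1}\frac1{|Q|}\int_Q|h-h_Q|\,dx+\sup_{|Q|>1}\frac1{|Q|}\int_Q|h|\,dx<\infty$, where $Q$ ranges over cubes and $h_Q$ is the average of $h$ over $Q$. *)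

theory Defs
  imports "HOL-Analysis.Analysis" "HOL-Probability.Essential_Supremum"
begin

definition cubes :: "(real ^ 'n) set set" where
  "cubes = {cbox a (\<chi> i. a $ i + l) | a l. 0 < l}"

definition locally_integrable :: "(real ^ 'n \<Rightarrow> real) \<Rightarrow> bool" where
  "locally_integrable h \<longleftrightarrow> (\<forall>K. compact K \<longrightarrow> h absolutely_integrable_on K)"

definition avg :: "(real ^ 'n) set \<Rightarrow> (real ^ 'n \<Rightarrow> real) \<Rightarrow> real" where
  "avg Q h = (LINT x:Q|lebesgue. h x) / measure lebesgue Q"

text \<open>Mean values of absolute values are taken in \<^typ>\<open>ennreal\<close>, so that they and the suprema
  below are never silently truncated when infinite.\<close>

definition abs_avg :: "(real ^ 'n) set \<Rightarrow> (real ^ 'n \<Rightarrow> real) \<Rightarrow> ennreal" where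
  "abs_avg Q h = (\<integral>\<^sup>+x\<in>Q. ennreal \<bar>h x\<bar> \<partial>lebesgue) / emeasure lebesgue Q"

definition bmo_norm :: "(real ^ 'n \<Rightarrow> real) \<Rightarrow> ennreal" where
  "bmo_norm h =
     (SUP Q\<in>{Q \<in> cubes. emeasure lebesgue Q \<le> 1}. abs_avg Q (\<lambda>x. h x - avg Q h)) +
     (SUP Q\<in>{Q \<in> cubes. emeasure lebesgue Q > 1}. abs_avg Q h)"

definition bmo :: "(real ^ 'n \<Rightarrow> real) set" where
  "bmo = {h. locally_integrable h \<and> bmo_norm h < \<infinity>}"

definition Linf_norm :: "(real ^ 'n \<Rightarrow> 'b::real_normed_vector) \<Rightarrow> ennreal" where
  "Linf_norm g = esssup lebesgue (\<lambda>x. ennreal (norm (g x)))"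

definition has_partial :: "'n \<Rightarrow> (real ^ 'n \<Rightarrow> real) \<Rightarrow> real ^ 'n \<Rightarrow> bool" where
  "has_partial i f x \<longleftrightarrow> (\<lambda>s. f (x + s *\<^sub>R axis i 1)) differentiable (at 0)"

definition partial :: "'n \<Rightarrow> (real ^ 'n \<Rightarrow> real) \<Rightarrow> real ^ 'n \<Rightarrow> real" where
  "partial i f x = deriv (\<lambda>s. f (x + s *\<^sub>R axis i 1)) 0"

definition grad :: "(real ^ 'n \<Rightarrow> real) \<Rightarrow> real ^ 'n \<Rightarrow> real ^ 'n" where
  "grad f x = (\<chi> i. partial i f x)"

text \<open>The norm of \<^typ>\<open>real ^ 'n ^ 'n\<close> is the Frobenius norm.\<close>

definition hessian :: "(real ^ 'n \<Rightarrow> real) \<Rightarrow> real ^ 'n \<Rightarrow> real ^ 'n ^ 'n" where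
  "hessian f x = (\<chi> i j. partial i (partial j f) x)"

definition laplacian :: "(real ^ 'n \<Rightarrow> real) \<Rightarrow> real ^ 'n \<Rightarrow> real" where
  "laplacian f x = (\<Sum>i\<in>UNIV. partial i (partial i f) x)"

definition time_deriv :: "(real \<Rightarrow> real ^ 'n \<Rightarrow> real) \<Rightarrow> real \<Rightarrow> real ^ 'n \<Rightarrow> real" where
  "time_deriv u t x = deriv (\<lambda>s. u s x) t"

text \<open>Regularity of class $C^{1,2}$ (once in time, twice in space) for positive times: the
  derivatives exist and are jointly continuous.\<close>

definition C12 :: "(real \<Rightarrow> real ^ 'n \<Rightarrow> real) \<Rightarrow> bool" where
  "C12 u \<longleftrightarrow>
     (\<forall>t>0. \<forall>x. (\<lambda>s. u s x) differentiable (at t)) \<and>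
     (\<forall>t>0. \<forall>x i. has_partial i (u t) x) \<and>
     (\<forall>t>0. \<forall>x i j. has_partial i (partial j (u t)) x) \<and>
     continuous_on ({0<..} \<times> UNIV) (\<lambda>(t, x). u t x) \<and>
     continuous_on ({0<..} \<times> UNIV) (\<lambda>(t, x). time_deriv u t x) \<and>
     (\<forall>i. continuous_on ({0<..} \<times> UNIV) (\<lambda>(t, x). partial i (u t) x)) \<and>
     (\<forall>i j. continuous_on ({0<..} \<times> UNIV) (\<lambda>(t, x). partial i (partial j (u t)) x))"

text \<open>Data in $bmo$ need not be continuous, so the initial value is attained in
  $L^1_{loc}$: the solution is classical for positive times and continuous up to time 0 as a
  curve in $L^1_{loc}$.\<close>

definition heat_solution ::
    "(real ^ 'n \<Rightarrow> real) \<Rightarrow> (real \<Rightarrow> real ^ 'n \<Rightarrow> real) \<Rightarrow> bool" where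
  "heat_solution u0 u \<longleftrightarrow>
     C12 u \<and>
     (\<forall>t>0. \<forall>x. time_deriv u t x - laplacian (u t) x = 0) \<and>
     u 0 = u0 \<and>
     (\<forall>K. compact K \<longrightarrow>
        ((\<lambda>t. \<integral>\<^sup>+x\<in>K. ennreal \<bar>u t x - u 0 x\<bar> \<partial>lebesgue) \<longlongrightarrow> 0) (at_right 0))"

end

theory Submission
  imports Defs "HOL-Probability.Distributions"
begin

text \<open>The solution is the convolution of \<open>u\<^sub>0\<close>, replaced by a Borel representative so that Tonelli
  applies on products, with the Gauss kernel \<open>G\<^sub>t\<close>. Averaging over translated cubes commutes with the
  convolution, which bounds the \<open>bmo\<close> norm. Since \<open>G\<^sub>t\<close> has mass 1, its space derivatives annihilate
  constants, so \<open>\<nabla>u(t, x)\<close> and \<open>\<nabla>\<^sup>2u(t, x)\<close> are integrals of \<open>u\<^sub>0 - c\<close>, where \<open>c\<close> belongs to the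
  cube of radius \<open>\<surd>t\<close> around \<open>x\<close>; the rapid decay of the kernel on the scale \<open>\<surd>t\<close> absorbs the polynomial
  growth of the oscillation over larger cubes. The time derivative is the Laplacian.
  The initial value is attained because translations are continuous in \<open>L\<^sup>1\<^sub>l\<^sub>o\<^sub>c\<close>.\<close>

section \<open>Cubes and weights\<close>

text \<open>The obstacle is that bmo data have no pointwise bound: only integrals over cubes are
  known. So the kernels are estimated by the polynomially decaying \<open>weight\<close>, whose
  integrals against functions reduce to sums over concentric cubes. The same weight serves
  convergence of the convolutions, domination when differentiating (both with \<open>r = 1\<close>)
  and the scale-invariant estimates with \<open>r = sqrt t\<close>. The two halves of the norm have
  different tasks. Large cubes make the convolution converge at all; oscillation yields the right
  powers of \<open>t\<close> for the derivatives. For the latter the halves merge: a cube of side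
  above 1 satisfies the oscillation bound with constant 0, so small and large \<open>t\<close> need
  no separate treatment. Oscillation is measured against an arbitrary constant, and passing to the
  mean costs a factor 2. The bmo bound for the extension pays it twice: once to get a centre
  depending measurably on the translate, once to return to the mean demanded by the norm.\<close>

abbreviation cube :: "real ^ 'n \<Rightarrow> real \<Rightarrow> (real ^ 'n) set" where
  "cube p l \<equiv> cbox p (\<chi> i. p $ i + l)"

lemma emeasure_cube:
  fixes p :: "real ^ 'n"
  assumes "0 \<le> l"
  shows "emeasure lborel (cube p l) = ennreal (l ^ CARD('n))"
proof -
  have "measure lborel (cube p l) = l ^ CARD('n)"
    using assms by (subst content_cbox_cart) (auto simp: interval_ne_empty_cart)
  moreover have "emeasure lborel (cube p l) = ennreal (measure lborel (cube p l))"
    using emeasure_lborel_cbox_finite by (intro emeasure_eq_ennreal_measure) (simp add: less_top)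
  ultimately show ?thesis
    by simp
qed

lemma mem_cube: "x \<in> cube p l \<longleftrightarrow> (\<forall>i. p $ i \<le> x $ i \<and> x $ i \<le> p $ i + l)"
  by (simp add: mem_box_cart)

section \<open>Invariance of Lebesgue measure under translation and reflection\<close>

lemma nn_integral_lborel_translate:
  fixes f :: "'a::euclidean_space \<Rightarrow> ennreal"
  assumes [measurable]: "f \<in> borel_measurable borel"
  shows "(\<integral>\<^sup>+x. f (c + x) \<partial>lborel) = (\<integral>\<^sup>+x. f x \<partial>lborel)"
  by (subst (2) lborel_affine[of 1 c]) (simp_all add: nn_integral_density nn_integral_distr)

lemma lborel_distr_reflect:
  fixes c :: "'a::euclidean_space"
  shows "distr lborel borel ((-) c) = lborel"
  by (subst (2) lborel_affine[of "-1" c]) (simp_all add: density_1)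

lemma nn_integral_lborel_reflect:
  fixes f :: "'a::euclidean_space \<Rightarrow> ennreal"
  assumes [measurable]: "f \<in> borel_measurable borel"
  shows "(\<integral>\<^sup>+x. f (c - x) \<partial>lborel) = (\<integral>\<^sup>+x. f x \<partial>lborel)"
  by (subst (2) lborel_distr_reflect[of c, symmetric]) (simp add: nn_integral_distr)

lemma integral_lborel_reflect:
  fixes f :: "'a::euclidean_space \<Rightarrow> real"
  assumes [measurable]: "f \<in> borel_measurable borel"
  shows "(\<integral>x. f (c - x) \<partial>lborel) = (\<integral>x. f x \<partial>lborel)"
  by (subst (2) lborel_distr_reflect[of c, symmetric]) (simp add: integral_distr)

lemma ennreal_abs_triangle:
  "ennreal \<bar>a - c\<bar> \<le> ennreal \<bar>a - b\<bar> + ennreal \<bar>b - c\<bar>"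
  by (subst ennreal_plus[symmetric]) (auto simp del: ennreal_plus intro!: ennreal_leI)

lemma nn_integral_const_cube:
  fixes p :: "real ^ 'n"
  assumes "0 \<le> l" "0 \<le> c"
  shows "(\<integral>\<^sup>+x\<in>cube p l. ennreal c \<partial>lborel) = ennreal (c * l ^ CARD('n))"
  using assms by (simp add: nn_integral_cmult_indicator emeasure_cube ennreal_mult)

text \<open>The mean differs from \<open>c\<close> by at most the average of
  \<open>\<bar>f x - c\<bar>\<close>; the triangle inequality then doubles the integral. This frees
  all later arguments to use whichever constant is convenient.\<close>

lemma mean_oscillation_le:
  fixes f :: "real ^ 'n \<Rightarrow> real"
  assumes f: "set_integrable lborel (cube p l) f" and l: "0 < l"
  shows "(\<integral>\<^sup>+x\<in>cube p l. ennreal \<bar>f x - (LINT x:cube p l|lborel. f x) / l ^ CARD('n)\<bar> \<partial>lborel)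
    \<le> 2 * (\<integral>\<^sup>+x\<in>cube p l. ennreal \<bar>f x - c\<bar> \<partial>lborel)"
proof -
  let ?Q = "cube p l"
  define m where "m = (LINT x:?Q|lborel. f x) / l ^ CARD('n)"
  have [measurable]: "(\<lambda>x. indicator ?Q x * f x) \<in> borel_measurable borel"
    using f by (simp add: set_integrable_def integrable_iff_bounded)
  have mq: "measure lborel ?Q = l ^ CARD('n)"
    using emeasure_cube[of l p] l by (simp add: measure_def)
  have ci: "set_integrable lborel ?Q (\<lambda>x. c)"
    unfolding set_integrable_def
    by (intro integrable_scaleR_left) (simp add: integrable_indicator_iff emeasure_lborel_cbox_eq)
  have "l ^ CARD('n) * (m - c) = (LINT x:?Q|lborel. f x) - (LINT x:?Q|lborel. c)"
    using l mq by (simp add: m_def set_lebesgue_integral_def field_simps)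
  also have "\<dots> = (LINT x:?Q|lborel. f x - c)"
    by (rule set_integral_diff(2)[symmetric, OF f ci])
  finally have e: "l ^ CARD('n) * (m - c) = (LINT x:?Q|lborel. f x - c)" .
  have "ennreal (l ^ CARD('n) * \<bar>m - c\<bar>) = ennreal (norm (LINT x:?Q|lborel. f x - c))"
    using l e by (metis abs_mult abs_of_pos real_norm_def zero_less_power)
  also have "\<dots> \<le> (\<integral>\<^sup>+x. ennreal (norm (indicator ?Q x *\<^sub>R (f x - c))) \<partial>lborel)"
    unfolding set_lebesgue_integral_def
    by (rule integral_norm_bound_ennreal)
      (use set_integral_diff(1)[OF f ci] in \<open>simp add: set_integrable_def\<close>)
  also have "\<dots> = (\<integral>\<^sup>+x\<in>?Q. ennreal \<bar>f x - c\<bar> \<partial>lborel)"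
    by (intro nn_integral_cong) (auto split: split_indicator)
  finally have mc: "ennreal (l ^ CARD('n) * \<bar>m - c\<bar>) \<le> (\<integral>\<^sup>+x\<in>?Q. ennreal \<bar>f x - c\<bar> \<partial>lborel)" .
  \<comment> \<open>\<open>set_integrable\<close> yields measurability of \<open>f\<close> only
    after multiplication by the indicator. The integrand is rewritten through that product, so that
    \<open>nn_integral_add\<close> applies.\<close>
  have me: "(\<lambda>x. ennreal \<bar>f x - c\<bar> * indicator ?Q x) = (\<lambda>x. ennreal \<bar>indicator ?Q x * f x - c\<bar> * indicator ?Q x)"
    by (auto split: split_indicator)
  have "(\<integral>\<^sup>+x\<in>?Q. ennreal \<bar>f x - m\<bar> \<partial>lborel)
      \<le> (\<integral>\<^sup>+x. ennreal \<bar>f x - c\<bar> * indicator ?Q x + ennreal \<bar>c - m\<bar> * indicator ?Q x \<partial>lborel)"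
    using ennreal_abs_triangle[of _ m c]
    by (intro nn_integral_mono) (auto simp: distrib_right[symmetric] intro!: mult_right_mono simp del: ennreal_plus)
  also have "\<dots> = (\<integral>\<^sup>+x\<in>?Q. ennreal \<bar>f x - c\<bar> \<partial>lborel) + (\<integral>\<^sup>+x\<in>?Q. ennreal \<bar>c - m\<bar> \<partial>lborel)"
    by (intro nn_integral_add) (unfold me, measurable)
  also have "(\<integral>\<^sup>+x\<in>?Q. ennreal \<bar>c - m\<bar> \<partial>lborel) = ennreal (l ^ CARD('n) * \<bar>m - c\<bar>)"
    using l nn_integral_const_cube[of l "\<bar>c - m\<bar>" p] by (simp add: abs_minus_commute mult.commute)
  also have "(\<integral>\<^sup>+x\<in>?Q. ennreal \<bar>f x - c\<bar> \<partial>lborel) + \<dots> \<le> 2 * (\<integral>\<^sup>+x\<in>?Q. ennreal \<bar>f x - c\<bar> \<partial>lborel)"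
    using mc by (simp add: mult_2 add_left_mono)
  finally show ?thesis
    by (simp add: m_def)
qed

text \<open>The exponent beats the growth \<open>k ^ (2 * CARD('n))\<close> of the oscillation integrals over the
  cubes of side \<open>2 k r\<close> around a point by a summable factor \<open>1 / k\<^sup>2\<close>.\<close>

definition weight :: "real \<Rightarrow> real ^ 'n \<Rightarrow> real" where
  "weight r z = 1 / (1 + norm z / r) ^ (2 * CARD('n) + 2)"

lemma weight_nonneg: "0 < r \<Longrightarrow> 0 \<le> weight r z"
  by (simp add: weight_def)

lemma weight_measurable [measurable]: "weight r \<in> borel_measurable borel"
  unfolding weight_def[abs_def] by measurable

text \<open>Take \<open>k\<close> to be the integer part of \<open>norm (x - y) / r\<close>. The
  lower bound \<open>k\<close> controls the weight, and the upper bound \<open>Suc k\<close> puts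
  \<open>y\<close> into the cube centred at \<open>x\<close> with half side
  \<open>Suc k * r\<close>.\<close>

lemma weight_le_sum_cubes:
  fixes x y :: "real ^ 'n"
  assumes "0 < r"
  obtains k :: nat where "weight r (x - y) \<le> 1 / real (Suc k) ^ (2 * CARD('n) + 2)"
    "y \<in> cube (\<chi> i. x $ i - real (Suc k) * r) (2 * real (Suc k) * r)"
proof
  define k where "k = nat \<lfloor>norm (x - y) / r\<rfloor>"
  have k: "real k \<le> norm (x - y) / r" "norm (x - y) / r \<le> real (Suc k)"
    using assms by (auto simp: k_def) linarith
  show "weight r (x - y) \<le> 1 / real (Suc k) ^ (2 * CARD('n) + 2)"
    unfolding weight_def using k assms
    by (intro divide_left_mono power_mono mult_pos_pos zero_less_power) (auto intro: add_pos_nonneg)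
  have n: "norm (x - y) \<le> real (Suc k) * r"
    using k(2) assms by (simp add: pos_divide_le_eq)
  have "\<bar>x $ i - y $ i\<bar> \<le> real (Suc k) * r" for i
    using component_le_norm_cart[of "x - y" i] n by simp
  then have "x $ i - real (Suc k) * r \<le> y $ i \<and> y $ i \<le> x $ i + real (Suc k) * r" for i
    by (smt (verit, best))
  then show "y \<in> cube (\<chi> i. x $ i - real (Suc k) * r) (2 * real (Suc k) * r)"
    by (intro mem_cube[THEN iffD2]) (auto simp: algebra_simps mem_box_cart)
qed

text \<open>The weight is dominated by a sum of multiples of indicators of concentric cubes. Only an
  upper bound is wanted, so overlapping cubes do as well as disjoint shells. Termwise,
  \<open>k ^ (2 * CARD('n))\<close> cancels and \<open>1 / k\<^sup>2\<close> remains.\<close>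

lemma nn_integral_weight_le:
  fixes x :: "real ^ 'n" and f :: "real ^ 'n \<Rightarrow> ennreal"
  assumes [measurable]: "f \<in> borel_measurable borel" and r: "0 < r" and D: "0 \<le> D"
    and f: "\<And>k::nat. 1 \<le> k \<Longrightarrow>
      (\<integral>\<^sup>+y\<in>cube (\<chi> i. x $ i - real k * r) (2 * real k * r). f y \<partial>lborel)
        \<le> ennreal (D * real k ^ (2 * CARD('n)))"
  shows "(\<integral>\<^sup>+y. ennreal (weight r (x - y)) * f y \<partial>lborel) \<le> ennreal (D * (\<Sum>k. 1 / real (Suc k) ^ 2))"
proof -
  let ?Q = "\<lambda>k::nat. cube (\<chi> i. x $ i - real (Suc k) * r) (2 * real (Suc k) * r)"
  let ?g = "\<lambda>k y. ennreal (1 / real (Suc k) ^ (2 * CARD('n) + 2)) * (f y * indicator (?Q k) y)"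
  have s: "summable (\<lambda>k. 1 / real (Suc k) ^ 2)"
    using inverse_squares_sums by (auto simp: sums_iff)
  have "(\<integral>\<^sup>+y. ennreal (weight r (x - y)) * f y \<partial>lborel) \<le> (\<integral>\<^sup>+y. (\<Sum>k. ?g k y) \<partial>lborel)"
  proof (rule nn_integral_mono)
    fix y
    obtain k where k: "weight r (x - y) \<le> 1 / real (Suc k) ^ (2 * CARD('n) + 2)" "y \<in> ?Q k"
      using weight_le_sum_cubes[OF r] by metis
    have "ennreal (weight r (x - y)) * f y \<le> ?g k y"
      using k by (auto intro!: mult_right_mono ennreal_leI)
    also have "\<dots> \<le> (\<Sum>k. ?g k y)"
      using sum_le_suminf[of "\<lambda>k. ?g k y" "{k}"] by simp
    finally show "ennreal (weight r (x - y)) * f y \<le> (\<Sum>k. ?g k y)" .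
  qed
  also have "\<dots> = (\<Sum>k. \<integral>\<^sup>+y. ?g k y \<partial>lborel)"
    by (rule nn_integral_suminf) measurable
  also have "\<dots> \<le> (\<Sum>k. ennreal (D * (1 / real (Suc k) ^ 2)))"
  proof (rule suminf_le)
    fix k
    have "(\<integral>\<^sup>+y. ?g k y \<partial>lborel) = ennreal (1 / real (Suc k) ^ (2 * CARD('n) + 2)) * (\<integral>\<^sup>+y\<in>?Q k. f y \<partial>lborel)"
      by (rule nn_integral_cmult) measurable
    also have "\<dots> \<le> ennreal (1 / real (Suc k) ^ (2 * CARD('n) + 2)) * ennreal (D * real (Suc k) ^ (2 * CARD('n)))"
      by (intro mult_left_mono f) auto
    also have "\<dots> = ennreal (D * (1 / real (Suc k) ^ 2))"
      using D unfolding power_add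
      by (subst ennreal_mult[symmetric]) (simp_all add: power2_eq_square)
    finally show "(\<integral>\<^sup>+y. ?g k y \<partial>lborel) \<le> ennreal (D * (1 / real (Suc k) ^ 2))" .
  qed auto
  also have "\<dots> = ennreal (\<Sum>k. D * (1 / real (Suc k) ^ 2))"
    using s D by (intro suminf_ennreal2 summable_mult) auto
  also have "(\<Sum>k. D * (1 / real (Suc k) ^ 2)) = D * (\<Sum>k. 1 / real (Suc k) ^ 2)"
    using s by (rule suminf_mult)
  finally show ?thesis .
qed

section \<open>Parameter integrals and convolutions\<close>

text \<open>Dominated convergence along sequences. The majorant may depend on \<open>p0\<close>,
  because the bounds for the kernels are uniform only for times in a compact interval and for
  \<open>x\<close> in a ball.\<close>

lemma continuous_on_integral_dominated:
  fixes f :: "'p::metric_space \<Rightarrow> 'a \<Rightarrow> real"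
  assumes meas: "\<And>p. p \<in> S \<Longrightarrow> f p \<in> borel_measurable M"
    and cont: "\<And>y. continuous_on S (\<lambda>p. f p y)"
    and dom: "\<And>p0. p0 \<in> S \<Longrightarrow> \<exists>e>0. \<exists>g. integrable M g \<and> (\<forall>p\<in>S \<inter> ball p0 e. \<forall>y. \<bar>f p y\<bar> \<le> g y)"
  shows "continuous_on S (\<lambda>p. \<integral>y. f p y \<partial>M)"
  unfolding continuous_on_def
proof
  fix p0 assume p0: "p0 \<in> S"
  obtain e g where e: "0 < e" and g: "integrable M g" and b: "\<And>p y. p \<in> S \<inter> ball p0 e \<Longrightarrow> \<bar>f p y\<bar> \<le> g y"
    using dom[OF p0] by metis
  have "((\<lambda>p. \<integral>y. f p y \<partial>M) \<longlongrightarrow> (\<integral>y. f p0 y \<partial>M)) (at p0 within (S \<inter> ball p0 e))"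
    unfolding tendsto_at_iff_sequentially comp_def
  proof (intro allI impI)
    fix X assume X: "\<forall>i. X i \<in> S \<inter> ball p0 e - {p0}" "X \<longlonglongrightarrow> p0"
    show "(\<lambda>i. \<integral>y. f (X i) y \<partial>M) \<longlonglongrightarrow> (\<integral>y. f p0 y \<partial>M)"
    proof (rule integral_dominated_convergence[OF _ _ g])
      show "AE y in M. (\<lambda>i. f (X i) y) \<longlonglongrightarrow> f p0 y"
      proof (intro AE_I2)
        fix y
        show "(\<lambda>i. f (X i) y) \<longlonglongrightarrow> f p0 y"
          by (rule continuous_on_tendsto_compose[OF cont X(2) p0]) (use X in auto)
      qed
    qed (use X b p0 meas in auto)
  qed
  also have "at p0 within (S \<inter> ball p0 e) = at p0 within S"
    using e by (intro at_within_nhd[where S="ball p0 e"]) auto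
  finally show "((\<lambda>p. \<integral>y. f p y \<partial>M) \<longlongrightarrow> (\<integral>y. f p0 y \<partial>M)) (at p0 within S)" .
qed

text \<open>By the mean value inequality the difference quotients inherit the majorant of the
  derivative. This is why the derivative is bounded on a whole ball and not just at
  \<open>s0\<close>.\<close>

lemma has_real_derivative_integral_dominated:
  fixes f f' :: "real \<Rightarrow> 'a \<Rightarrow> real"
  assumes e: "0 < e"
    and deriv: "\<And>s y. s \<in> ball s0 e \<Longrightarrow> ((\<lambda>s. f s y) has_real_derivative f' s y) (at s)"
    and int: "\<And>s. s \<in> ball s0 e \<Longrightarrow> integrable M (f s)"
    and g: "integrable M g" and b: "\<And>s y. s \<in> ball s0 e \<Longrightarrow> \<bar>f' s y\<bar> \<le> g y"
    and meas: "f' s0 \<in> borel_measurable M"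
  shows "((\<lambda>s. \<integral>y. f s y \<partial>M) has_real_derivative (\<integral>y. f' s0 y \<partial>M)) (at s0)"
proof -
  have s0: "s0 \<in> ball s0 e" using e by simp
  have "((\<lambda>s. ((\<integral>y. f s y \<partial>M) - (\<integral>y. f s0 y \<partial>M)) / (s - s0)) \<longlongrightarrow> (\<integral>y. f' s0 y \<partial>M)) (at s0 within ball s0 e)"
    unfolding tendsto_at_iff_sequentially comp_def
  proof (intro allI impI)
    fix X assume X: "\<forall>i. X i \<in> ball s0 e - {s0}" "X \<longlonglongrightarrow> s0"
    have "(\<lambda>i. \<integral>y. (f (X i) y - f s0 y) / (X i - s0) \<partial>M) \<longlonglongrightarrow> (\<integral>y. f' s0 y \<partial>M)"
    proof (rule integral_dominated_convergence[OF meas _ g])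
      show "(\<lambda>y. (f (X i) y - f s0 y) / (X i - s0)) \<in> borel_measurable M" for i
        using int[of "X i"] int[OF s0] X by (intro borel_measurable_divide borel_measurable_diff) auto
      show "AE y in M. (\<lambda>i. (f (X i) y - f s0 y) / (X i - s0)) \<longlonglongrightarrow> f' s0 y"
      proof (intro AE_I2)
        fix y
        have "((\<lambda>s. (f s y - f s0 y) / (s - s0)) \<longlongrightarrow> f' s0 y) (at s0)"
          using deriv[OF s0] by (simp add: has_field_derivative_iff)
        then show "(\<lambda>i. (f (X i) y - f s0 y) / (X i - s0)) \<longlonglongrightarrow> f' s0 y"
          using X by (auto simp: tendsto_at_iff_sequentially comp_def)
      qed
      show "AE y in M. norm ((f (X i) y - f s0 y) / (X i - s0)) \<le> g y" for i
      proof (intro AE_I2)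
        fix y
        have "norm (f (X i) y - f s0 y) \<le> g y * norm (X i - s0)"
          using X s0 deriv b
          by (intro field_differentiable_bound[of "ball s0 e" "\<lambda>s. f s y" "\<lambda>s. f' s y"])
            (auto intro: has_field_derivative_at_within)
        then show "norm ((f (X i) y - f s0 y) / (X i - s0)) \<le> g y"
          using X by (auto simp: norm_divide divide_simps)
      qed
    qed
    moreover have "(\<integral>y. (f (X i) y - f s0 y) / (X i - s0) \<partial>M) = ((\<integral>y. f (X i) y \<partial>M) - (\<integral>y. f s0 y \<partial>M)) / (X i - s0)" for i
      using int[of "X i"] int[OF s0] X by (subst integral_divide_zero, subst Bochner_Integration.integral_diff) auto
    ultimately show "(\<lambda>i. ((\<integral>y. f (X i) y \<partial>M) - (\<integral>y. f s0 y \<partial>M)) / (X i - s0)) \<longlonglongrightarrow> (\<integral>y. f' s0 y \<partial>M)"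
      by (simp only:)
  qed
  then show ?thesis
    using at_within_open[OF s0] by (simp add: has_field_derivative_iff)
qed

text \<open>Decay faster than any power, uniformly on compact intervals of positive times. Asking
  for every \<open>M\<close> makes the class stable under multiplication by coordinates, so it
  contains the derivatives of the Gauss kernel along with the kernel itself.\<close>

definition admissible :: "(real \<Rightarrow> real ^ 'n \<Rightarrow> real) \<Rightarrow> bool" where
  "admissible K \<longleftrightarrow> continuous_on ({0<..} \<times> UNIV) (\<lambda>(t, z). K t z) \<and>
     (\<forall>t1 t2. \<forall>M::nat. 0 < t1 \<longrightarrow> (\<exists>A. \<forall>t\<in>{t1..t2}. \<forall>z. \<bar>K t z\<bar> * (1 + norm z) ^ M \<le> A))"

lemma admissible_cmult:
  fixes c :: "real \<Rightarrow> real"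
  assumes K: "admissible K" and c: "continuous_on {0<..} c"
  shows "admissible (\<lambda>t z. c t * K t z)"
  unfolding admissible_def
proof (intro conjI allI impI)
  have "continuous_on ({0<..} \<times> UNIV) (\<lambda>p. c (fst p))"
    by (rule continuous_on_compose2[OF c]) (auto intro: continuous_intros)
  moreover have "continuous_on ({0<..} \<times> UNIV) (\<lambda>p. K (fst p) (snd p))"
    using K by (simp add: admissible_def case_prod_unfold)
  ultimately show "continuous_on ({0<..} \<times> UNIV) (\<lambda>(t, z). c t * K t z)"
    unfolding case_prod_unfold by (rule continuous_on_mult)
next
  fix t1 t2 :: real and M :: nat assume t1: "0 < t1"
  obtain A where A: "\<And>t z. t \<in> {t1..t2} \<Longrightarrow> \<bar>K t z\<bar> * (1 + norm z) ^ M \<le> A"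
    using K t1 unfolding admissible_def by meson
  have "bounded (c ` {t1..t2})"
    using t1 by (intro compact_imp_bounded compact_continuous_image continuous_on_subset[OF c]) auto
  then obtain B where B: "\<And>t. t \<in> {t1..t2} \<Longrightarrow> \<bar>c t\<bar> \<le> B"
    unfolding bounded_iff by (metis imageI real_norm_def)
  show "\<exists>A. \<forall>t\<in>{t1..t2}. \<forall>z. \<bar>c t * K t z\<bar> * (1 + norm z) ^ M \<le> A"
  proof (intro exI ballI allI)
    fix t z assume t: "t \<in> {t1..t2}"
    have "\<bar>c t\<bar> * (\<bar>K t z\<bar> * (1 + norm z) ^ M) \<le> B * A"
      using A[OF t] B[OF t] by (intro mult_mono) auto
    then show "\<bar>c t * K t z\<bar> * (1 + norm z) ^ M \<le> B * A"
      by (simp add: abs_mult mult.assoc)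
  qed
qed

text \<open>The coordinate costs one power of \<open>1 + norm z\<close>; the bound for
  \<open>Suc M\<close> pays for it.\<close>

lemma admissible_component:
  assumes K: "admissible K"
  shows "admissible (\<lambda>t z. z $ i * K t z)"
  unfolding admissible_def
proof (intro conjI allI impI)
  have "continuous_on ({0<..} \<times> UNIV) (\<lambda>p. K (fst p) (snd p))"
    using K by (simp add: admissible_def case_prod_unfold)
  then show "continuous_on ({0<..} \<times> UNIV) (\<lambda>(t, z). z $ i * K t z)"
    unfolding case_prod_unfold by (intro continuous_intros)
next
  fix t1 t2 :: real and M :: nat assume t1: "0 < t1"
  obtain A where A: "\<And>t z. t \<in> {t1..t2} \<Longrightarrow> \<bar>K t z\<bar> * (1 + norm z) ^ Suc M \<le> A"
    using K t1 unfolding admissible_def by meson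
  show "\<exists>A. \<forall>t\<in>{t1..t2}. \<forall>z. \<bar>z $ i * K t z\<bar> * (1 + norm z) ^ M \<le> A"
  proof (intro exI ballI allI)
    fix t z assume t: "t \<in> {t1..t2}"
    have "\<bar>z $ i\<bar> * (\<bar>K t z\<bar> * (1 + norm z) ^ M) \<le> (1 + norm z) * (\<bar>K t z\<bar> * (1 + norm z) ^ M)"
      using component_le_norm_cart[of z i] by (intro mult_right_mono) auto
    also have "\<dots> = \<bar>K t z\<bar> * (1 + norm z) ^ Suc M"
      by simp
    finally show "\<bar>z $ i * K t z\<bar> * (1 + norm z) ^ M \<le> A"
      using A[OF t, of z] by (simp add: abs_mult mult.assoc)
  qed
qed

lemma admissible_add:
  assumes K: "admissible K" and L: "admissible L"
  shows "admissible (\<lambda>t z. K t z + L t z)"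
  unfolding admissible_def
proof (intro conjI allI impI)
  show "continuous_on ({0<..} \<times> UNIV) (\<lambda>(t, z). K t z + L t z)"
    using K L unfolding admissible_def case_prod_unfold by (intro continuous_intros) auto
next
  fix t1 t2 :: real and M :: nat assume t1: "0 < t1"
  obtain A where A: "\<And>t z. t \<in> {t1..t2} \<Longrightarrow> \<bar>K t z\<bar> * (1 + norm z) ^ M \<le> A"
    using K t1 unfolding admissible_def by meson
  obtain B where B: "\<And>t z. t \<in> {t1..t2} \<Longrightarrow> \<bar>L t z\<bar> * (1 + norm z) ^ M \<le> B"
    using L t1 unfolding admissible_def by meson
  show "\<exists>A. \<forall>t\<in>{t1..t2}. \<forall>z. \<bar>K t z + L t z\<bar> * (1 + norm z) ^ M \<le> A"
  proof (intro exI ballI allI)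
    fix t z assume t: "t \<in> {t1..t2}"
    have "\<bar>K t z + L t z\<bar> * (1 + norm z) ^ M \<le> (\<bar>K t z\<bar> + \<bar>L t z\<bar>) * (1 + norm z) ^ M"
      by (intro mult_right_mono) auto
    then show "\<bar>K t z + L t z\<bar> * (1 + norm z) ^ M \<le> A + B"
      using A[OF t, of z] B[OF t, of z] by (simp add: distrib_right)
  qed
qed

lemma admissible_zero: "admissible (\<lambda>t z. 0)"
  by (auto simp: admissible_def)

lemma admissible_sum:
  assumes "\<And>i. i \<in> I \<Longrightarrow> admissible (K i)"
  shows "admissible (\<lambda>t z. \<Sum>i\<in>I. K i t z)"
  using assms by (induction I rule: infinite_finite_induct) (simp_all add: admissible_zero admissible_add)

lemma admissible_borel:
  assumes "admissible K" "0 < t"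
  shows "K t \<in> borel_measurable borel"
proof -
  have "continuous_on UNIV (\<lambda>z. (\<lambda>(t, z). K t z) (t, z))"
    using assms unfolding admissible_def
    by (intro continuous_on_compose2[of "{0<..} \<times> UNIV" "\<lambda>(t, z). K t z" UNIV "\<lambda>z. (t, z)"])
      (auto intro: continuous_intros)
  then show ?thesis
    by (simp add: borel_measurable_continuous_onI)
qed

section \<open>Convolutions with rapidly decaying kernels\<close>

definition convolve :: "(real \<Rightarrow> real ^ 'n \<Rightarrow> real) \<Rightarrow> (real ^ 'n \<Rightarrow> real) \<Rightarrow> real \<Rightarrow> real ^ 'n \<Rightarrow> real" where
  "convolve K v t x = (\<integral>y. K t (x - y) * v y \<partial>lborel)"

text \<open>The setting in which convolutions with admissible kernels converge and may be
  differentiated. It is instantiated twice: with bmo data, and with constants, where differentiating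
  the mass identity gives the cancellation of the derivative kernels.\<close>

locale weighted_integrable =
  fixes v :: "real ^ 'n \<Rightarrow> real"
  assumes v_borel [measurable]: "v \<in> borel_measurable borel"
    and weight_integrable: "\<And>x. integrable lborel (\<lambda>y. weight 1 (x - y) * \<bar>v y\<bar>)"
begin

text \<open>Moving \<open>x\<close> within the unit ball around \<open>x0\<close> changes
  \<open>1 + norm (x - y)\<close> by a factor of at most 2. Hence one multiple of the weight centred
  at \<open>x0\<close> dominates for all these \<open>x\<close> simultaneously.\<close>

lemma convolve_dominated:
  assumes K: "admissible K" and t1: "0 < t1"
  obtains g where "integrable lborel g"
    "\<And>t x y. t \<in> {t1..t2} \<Longrightarrow> x \<in> ball x0 1 \<Longrightarrow> \<bar>K t (x - y) * v y\<bar> \<le> g y"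
proof -
  obtain A where A: "\<And>t z. t \<in> {t1..t2} \<Longrightarrow> \<bar>K t z\<bar> * (1 + norm z) ^ (2 * CARD('n) + 2) \<le> A"
    using K t1 unfolding admissible_def by meson
  show thesis
  proof
    show "integrable lborel (\<lambda>y. (A * 2 ^ (2 * CARD('n) + 2)) * (weight 1 (x0 - y) * \<bar>v y\<bar>))"
      by (intro integrable_mult_right weight_integrable)
    fix t x y assume t: "t \<in> {t1..t2}" and x: "x \<in> ball x0 1"
    have pos: "0 < 1 + norm (x - y)" "0 < 1 + norm (x0 - y)"
      by (auto intro: add_pos_nonneg)
    have A0: "0 \<le> A"
      using A[OF t, of "x - y"] by (rule order_trans[rotated]) auto
    have "norm (x0 - y) \<le> norm (x0 - x) + norm (x - y)"
      using norm_triangle_ineq[of "x0 - x" "x - y"] by simp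
    then have n: "1 + norm (x0 - y) \<le> 2 * (1 + norm (x - y))"
      using x norm_ge_zero[of "x - y"] unfolding mem_ball dist_norm distrib_left by linarith
    have "\<bar>K t (x - y)\<bar> \<le> A / (1 + norm (x - y)) ^ (2 * CARD('n) + 2)"
      using A[OF t, of "x - y"] pos by (simp add: pos_le_divide_eq)
    also have "\<dots> = A * 2 ^ (2 * CARD('n) + 2) / (2 * (1 + norm (x - y))) ^ (2 * CARD('n) + 2)"
      by (simp only: power_mult_distrib) simp
    also have "\<dots> \<le> A * 2 ^ (2 * CARD('n) + 2) / (1 + norm (x0 - y)) ^ (2 * CARD('n) + 2)"
      using n pos A0 by (intro divide_left_mono power_mono mult_pos_pos zero_less_power) auto
    finally have "\<bar>K t (x - y)\<bar> \<le> A * 2 ^ (2 * CARD('n) + 2) * weight 1 (x0 - y)"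
      by (simp add: weight_def)
    then show "\<bar>K t (x - y) * v y\<bar> \<le> (A * 2 ^ (2 * CARD('n) + 2)) * (weight 1 (x0 - y) * \<bar>v y\<bar>)"
      unfolding abs_mult mult.assoc[symmetric] by (intro mult_right_mono) auto
  qed
qed

lemma convolve_measurable:
  assumes "admissible K" "0 < t"
  shows "(\<lambda>y. K t (x - y) * v y) \<in> borel_measurable borel"
proof -
  note [measurable] = admissible_borel[OF assms]
  show ?thesis by measurable
qed

lemma convolve_integrable:
  assumes K: "admissible K" and t: "0 < t"
  shows "integrable lborel (\<lambda>y. K t (x - y) * v y)"
proof -
  obtain g where g: "integrable lborel g"
    "\<And>s x' y. s \<in> {t..t} \<Longrightarrow> x' \<in> ball x 1 \<Longrightarrow> \<bar>K s (x' - y) * v y\<bar> \<le> g y"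
    using convolve_dominated[OF K t] by metis
  show ?thesis
  proof (rule Bochner_Integration.integrable_bound[OF g(1)])
    show "AE y in lborel. norm (K t (x - y) * v y) \<le> norm (g y)"
    proof (intro AE_I2)
      fix y
      have "\<bar>K t (x - y) * v y\<bar> \<le> g y" by (rule g(2)) auto
      then show "norm (K t (x - y) * v y) \<le> norm (g y)" by simp
    qed
  qed (use convolve_measurable[OF K t] in simp)
qed

lemma convolve_continuous:
  assumes K: "admissible K"
  shows "continuous_on ({0<..} \<times> UNIV) (\<lambda>(t, x). convolve K v t x)"
  unfolding convolve_def case_prod_unfold
proof (rule continuous_on_integral_dominated)
  fix p :: "real \<times> (real ^ 'n)" assume p: "p \<in> {0<..} \<times> UNIV"
  show "(\<lambda>y. K (fst p) (snd p - y) * v y) \<in> borel_measurable lborel"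
    using convolve_measurable[OF K, of "fst p"] p by auto
  obtain t0 x0 where p0: "p = (t0, x0)" "0 < t0"
    using p by auto
  obtain g where g: "integrable lborel g"
    "\<And>t x y. t \<in> {t0 / 2..2 * t0} \<Longrightarrow> x \<in> ball x0 1 \<Longrightarrow> \<bar>K t (x - y) * v y\<bar> \<le> g y"
    using convolve_dominated[OF K, of "t0 / 2"] p0 by (metis half_gt_zero)
  show "\<exists>e>0. \<exists>g. integrable lborel g \<and>
      (\<forall>q\<in>({0<..} \<times> UNIV) \<inter> ball p e. \<forall>y. \<bar>K (fst q) (snd q - y) * v y\<bar> \<le> g y)"
  proof (intro exI conjI ballI allI)
    show "0 < min 1 (t0 / 2)" using p0 by simp
    fix q y assume "q \<in> ({0<..} \<times> UNIV) \<inter> ball p (min 1 (t0 / 2))"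
    then have "dist p q < min 1 (t0 / 2)" by simp
    then have "dist t0 (fst q) < t0 / 2" "dist x0 (snd q) < 1"
      using dist_fst_le[of p q] dist_snd_le[of p q] p0 by auto
    moreover have "fst q \<in> {t0 / 2..2 * t0}"
      using calculation(1) p0(2) unfolding dist_real_def atLeastAtMost_iff by arith
    ultimately show "\<bar>K (fst q) (snd q - y) * v y\<bar> \<le> g y"
      by (intro g) auto
  qed fact
next
  fix y
  have K1: "continuous_on ({0<..} \<times> UNIV) (\<lambda>(t, z). K t z)"
    using K by (simp add: admissible_def)
  have c: "continuous_on ({0<..} \<times> UNIV) (\<lambda>p :: real \<times> (real ^ 'n). (fst p, snd p - y))"
    by (intro continuous_intros)
  have "(\<lambda>p :: real \<times> (real ^ 'n). (fst p, snd p - y)) ` ({0<..} \<times> UNIV) \<subseteq> {0<..} \<times> UNIV"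
    by auto
  from continuous_on_compose2[OF K1 c this]
  have "continuous_on ({0<..} \<times> UNIV) (\<lambda>p. K (fst p) (snd p - y))"
    by simp
  then show "continuous_on ({0<..} \<times> UNIV) (\<lambda>p. K (fst p) (snd p - y) * v y)"
    by (intro continuous_on_mult_right) simp
qed

lemma convolve_has_partial_derivative:
  assumes K: "admissible K" and K': "admissible K'" and t: "0 < t"
    and d: "\<And>z. ((\<lambda>s. K t (z + s *\<^sub>R axis i 1)) has_real_derivative K' t z) (at 0)"
  shows "((\<lambda>s. convolve K v t (x + s *\<^sub>R axis i 1)) has_real_derivative convolve K' v t x) (at 0)"
proof -
  obtain g where g: "integrable lborel g"
    "\<And>s x' y. s \<in> {t..t} \<Longrightarrow> x' \<in> ball x 1 \<Longrightarrow> \<bar>K' s (x' - y) * v y\<bar> \<le> g y"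
    using convolve_dominated[OF K' t] by metis
  have "((\<lambda>s. \<integral>y. K t (x + s *\<^sub>R axis i 1 - y) * v y \<partial>lborel) has_real_derivative
      (\<integral>y. K' t (x + 0 *\<^sub>R axis i 1 - y) * v y \<partial>lborel)) (at 0)"
  proof (rule has_real_derivative_integral_dominated[where e=1 and g=g])
    fix s :: real and y assume s: "s \<in> ball 0 1"
    \<comment> \<open>The hypothesis \<open>d\<close> differentiates at parameter 0, but from every
      base point. Rebasing at the point reached at parameter \<open>s\<close> gives the derivative
      on the whole interval.\<close>
    have "((\<lambda>h. K t (x + s *\<^sub>R axis i 1 - y + h *\<^sub>R axis i 1)) has_real_derivative K' t (x + s *\<^sub>R axis i 1 - y)) (at (s + - s))"
      using d by simp
    then have "((\<lambda>h. K t (x + s *\<^sub>R axis i 1 - y + (h + - s) *\<^sub>R axis i 1)) has_real_derivative K' t (x + s *\<^sub>R axis i 1 - y)) (at s)"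
      by (rule DERIV_shift[THEN iffD1])
    then have "((\<lambda>h. K t (x + h *\<^sub>R axis i 1 - y)) has_real_derivative K' t (x + s *\<^sub>R axis i 1 - y)) (at s)"
      by (simp add: algebra_simps)
    then show "((\<lambda>h. K t (x + h *\<^sub>R axis i 1 - y) * v y) has_real_derivative K' t (x + s *\<^sub>R axis i 1 - y) * v y) (at s)"
      by (rule DERIV_cmult_right)
    show "\<bar>K' t (x + s *\<^sub>R axis i 1 - y) * v y\<bar> \<le> g y"
      using s by (intro g(2)) (auto simp: dist_norm)
  qed (use g(1) convolve_integrable[OF K t] convolve_measurable[OF K' t, of x] in auto)
  then show ?thesis
    by (simp add: convolve_def)
qed

lemma convolve_has_time_derivative:
  assumes K: "admissible K" and K': "admissible K'" and t: "0 < t"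
    and d: "\<And>t z. 0 < t \<Longrightarrow> ((\<lambda>s. K s z) has_real_derivative K' t z) (at t)"
  shows "((\<lambda>s. convolve K v s x) has_real_derivative convolve K' v t x) (at t)"
proof -
  obtain g where g: "integrable lborel g"
    "\<And>s x' y. s \<in> {t / 2..2 * t} \<Longrightarrow> x' \<in> ball x 1 \<Longrightarrow> \<bar>K' s (x' - y) * v y\<bar> \<le> g y"
    using convolve_dominated[OF K', of "t / 2"] t by (metis half_gt_zero)
  have pos: "t / 2 < s \<and> s < 2 * t" if "s \<in> ball t (t / 2)" for s
    using that t unfolding mem_ball dist_real_def by arith
  show ?thesis
    unfolding convolve_def
  proof (rule has_real_derivative_integral_dominated[where e="t / 2" and g=g])
    fix s :: real and y assume s: "s \<in> ball t (t / 2)"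
    show "((\<lambda>s. K s (x - y) * v y) has_real_derivative K' s (x - y) * v y) (at s)"
      using pos[OF s] t by (intro DERIV_cmult_right d) auto
    show "\<bar>K' s (x - y) * v y\<bar> \<le> g y"
      using pos[OF s] by (intro g(2)) auto
  next
    fix s :: real assume s: "s \<in> ball t (t / 2)"
    show "integrable lborel (\<lambda>y. K s (x - y) * v y)"
      using pos[OF s] t by (intro convolve_integrable[OF K]) auto
  qed (use g(1) t convolve_measurable[OF K' t, of x] in auto)
qed

end

section \<open>The heat kernel\<close>

text \<open>The usual factor \<open>(4 * pi * t)\<close> to the power \<open>- CARD('n) / 2\<close>
  is moved into the exponential. Positivity is then immediate for every \<open>t\<close>, and
  differentiation only meets one exponential.\<close>

definition heat_kernel :: "real \<Rightarrow> real ^ 'n \<Rightarrow> real" where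
  "heat_kernel t z = exp (- (real CARD('n) / 2) * ln (4 * pi * t) - (norm z)\<^sup>2 / (4 * t))"

text \<open>The derivative kernels have the nested shape \<open>c t * (z $ i * ...)\<close>, to
  which the closure rules of \<open>admissible\<close> apply directly.\<close>

definition heat_kernel_d :: "'n \<Rightarrow> real \<Rightarrow> real ^ 'n \<Rightarrow> real" where
  "heat_kernel_d i t z = - (1 / (2 * t)) * (z $ i * heat_kernel t z)"

definition heat_kernel_d2 :: "'n \<Rightarrow> 'n \<Rightarrow> real \<Rightarrow> real ^ 'n \<Rightarrow> real" where
  "heat_kernel_d2 i j t z = 1 / (4 * t\<^sup>2) * (z $ i * (z $ j * heat_kernel t z))
     + (- (if i = j then 1 else 0) / (2 * t)) * heat_kernel t z"

text \<open>Declared as the Laplacian of the kernel. The heat equation for the convolution thus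
  follows by linearity, and the computation is concentrated in
  \<open>heat_kernel_time_deriv\<close>.\<close>

definition heat_kernel_dt :: "real \<Rightarrow> real ^ 'n \<Rightarrow> real" where
  "heat_kernel_dt t z = (\<Sum>i\<in>UNIV. heat_kernel_d2 i i t z)"

lemma heat_kernel_pos: "0 < heat_kernel t z"
  by (simp add: heat_kernel_def)

lemma heat_kernel_eq:
  fixes z :: "real ^ 'n"
  assumes "0 < t"
  shows "heat_kernel t z = (1 / sqrt (4 * pi * t)) ^ CARD('n) * exp (- (norm z / sqrt t)\<^sup>2 / 4)"
proof -
  have "exp (- (real CARD('n) / 2) * ln (4 * pi * t)) = (1 / sqrt (4 * pi * t)) ^ CARD('n)"
  proof -
    have "exp (- (real CARD('n) / 2) * ln (4 * pi * t)) = exp (- ln (sqrt (4 * pi * t))) ^ CARD('n)"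
      using assms by (subst exp_of_nat_mult[symmetric]) (simp add: ln_sqrt field_simps)
    also have "exp (- ln (sqrt (4 * pi * t))) = 1 / sqrt (4 * pi * t)"
      using assms by (subst exp_minus, subst exp_ln) (auto simp: divide_inverse)
    finally show ?thesis .
  qed
  moreover have "- (norm z / sqrt t)\<^sup>2 / 4 = - ((norm z)\<^sup>2 / (4 * t))"
    using assms by (simp add: power_divide)
  ultimately show ?thesis
    unfolding heat_kernel_def using exp_add[of "- (real CARD('n) / 2) * ln (4 * pi * t)" "- ((norm z)\<^sup>2 / (4 * t))"]
    by simp
qed

lemma power_le_fact_exp:
  fixes x :: real
  assumes "0 \<le> x"
  shows "x ^ n \<le> fact n * exp x"
proof -
  have "(\<Sum>k\<in>{n}. inverse (fact k) *\<^sub>R x ^ k) \<le> (\<Sum>k. inverse (fact k) *\<^sub>R x ^ k)"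
    using assms by (intro sum_le_suminf summable_exp_generic) auto
  then have "inverse (fact n) * x ^ n \<le> exp x"
    by (simp add: exp_def)
  then show ?thesis
    by (simp add: field_simps)
qed

text \<open>In the scale-free variable \<open>s = norm z / sqrt t\<close>, a power of
  \<open>1 + s\<close> is at most \<open>fact M * exp (1 + s)\<close>. Completing the square gives
  \<open>1 + s - s\<^sup>2 / 4 \<le> 2\<close>, which is the origin of \<open>exp 2\<close>.\<close>

lemma heat_kernel_decay:
  fixes z :: "real ^ 'n"
  assumes t: "0 < t"
  shows "heat_kernel t z * (1 + norm z / sqrt t) ^ M \<le> fact M * exp 2 / sqrt t ^ CARD('n)"
proof -
  define s where "s = norm z / sqrt t"
  have s: "0 \<le> s"
    using t by (simp add: s_def)
  have c: "(1 / sqrt (4 * pi * t)) ^ CARD('n) \<le> (1 / sqrt t) ^ CARD('n)"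
    using t pi_ge_two by (intro power_mono divide_left_mono real_sqrt_le_mono mult_pos_pos) auto
  have "1 + s + - s\<^sup>2 / 4 \<le> 2"
    using zero_le_power2[of "s / 2 - 1"] by (simp add: power2_eq_square algebra_simps)
  then have "exp (- s\<^sup>2 / 4) * exp (1 + s) \<le> exp 2"
    unfolding exp_add[symmetric] exp_le_cancel_iff by linarith
  then have "fact M * (exp (- s\<^sup>2 / 4) * exp (1 + s)) \<le> fact M * exp 2"
    by (rule mult_left_mono) simp
  moreover have "exp (- s\<^sup>2 / 4) * (1 + s) ^ M \<le> exp (- s\<^sup>2 / 4) * (fact M * exp (1 + s))"
    using s by (intro mult_left_mono power_le_fact_exp) auto
  ultimately have e: "exp (- s\<^sup>2 / 4) * (1 + s) ^ M \<le> fact M * exp 2"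
    unfolding mult.left_commute[of "fact M"] by (rule order_trans[rotated])
  have "(1 / sqrt (4 * pi * t)) ^ CARD('n) * (exp (- s\<^sup>2 / 4) * (1 + s) ^ M)
      \<le> (1 / sqrt t) ^ CARD('n) * (fact M * exp 2)"
    by (rule mult_mono[OF c e]) (use s t in auto)
  then show ?thesis
    using t by (simp add: heat_kernel_eq s_def power_one_over mult.assoc)
qed

text \<open>Scale-free decay becomes decay in \<open>norm z\<close> through
  \<open>1 + norm z \<le> (1 + sqrt t) * (1 + norm z / sqrt t)\<close>. The resulting bound grows
  with \<open>t2\<close> and blows up as \<open>t1\<close> tends to 0.\<close>

lemma admissible_heat_kernel: "admissible (heat_kernel :: real \<Rightarrow> real ^ 'n \<Rightarrow> real)"
  unfolding admissible_def
proof (intro conjI allI impI)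
  show "continuous_on ({0<..} \<times> UNIV) (\<lambda>(t, z :: real ^ 'n). heat_kernel t z)"
    unfolding heat_kernel_def case_prod_unfold by (auto intro!: continuous_intros)
next
  fix t1 t2 :: real and M :: nat assume t1: "0 < t1"
  show "\<exists>A. \<forall>t\<in>{t1..t2}. \<forall>z :: real ^ 'n. \<bar>heat_kernel t z\<bar> * (1 + norm z) ^ M \<le> A"
  proof (intro exI ballI allI)
    fix t and z :: "real ^ 'n" assume t: "t \<in> {t1..t2}"
    have t0: "0 < t" using t t1 by auto
    have "1 + norm z \<le> (1 + sqrt t) * (1 + norm z / sqrt t)"
      using t0 by (simp add: field_simps)
    then have "(1 + norm z) ^ M \<le> ((1 + sqrt t) * (1 + norm z / sqrt t)) ^ M"
      by (rule power_mono) simp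
    then have "heat_kernel t z * (1 + norm z) ^ M \<le> (1 + sqrt t) ^ M * (heat_kernel t z * (1 + norm z / sqrt t) ^ M)"
      using heat_kernel_pos[of t z] by (simp add: power_mult_distrib mult.left_commute)
    also have "\<dots> \<le> (1 + sqrt t2) ^ M * (fact M * exp 2 / sqrt t1 ^ CARD('n))"
    proof (rule mult_mono)
      have "fact M * exp 2 / sqrt t ^ CARD('n) \<le> fact M * exp 2 / sqrt t1 ^ CARD('n)"
        using t t1 t0 by (intro divide_left_mono power_mono mult_pos_pos zero_less_power) auto
      then show "heat_kernel t z * (1 + norm z / sqrt t) ^ M \<le> fact M * exp 2 / sqrt t1 ^ CARD('n)"
        using heat_kernel_decay[OF t0, of z M] by linarith
      show "(1 + sqrt t) ^ M \<le> (1 + sqrt t2) ^ M"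
        using t t0 by (intro power_mono) auto
    qed (use t t0 heat_kernel_pos[of t z] in \<open>auto intro!: mult_nonneg_nonneg simp: less_imp_le\<close>)
    finally show "\<bar>heat_kernel t z\<bar> * (1 + norm z) ^ M \<le> (1 + sqrt t2) ^ M * (fact M * exp 2 / sqrt t1 ^ CARD('n))"
      using heat_kernel_pos[of t z] by simp
  qed
qed

lemma admissible_heat_kernel_d: "admissible (heat_kernel_d i)"
  unfolding heat_kernel_d_def
  by (intro admissible_cmult[where c="\<lambda>t. - (1 / (2 * t))"] admissible_component admissible_heat_kernel)
    (auto intro!: continuous_intros)

lemma admissible_heat_kernel_d2: "admissible (heat_kernel_d2 i j)"
  unfolding heat_kernel_d2_def
  by (intro admissible_add
      admissible_cmult[where c="\<lambda>t. 1 / (4 * t\<^sup>2)"]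
      admissible_cmult[where c="\<lambda>t. - (if i = j then 1 else 0) / (2 * t)"] admissible_component admissible_heat_kernel)
    (auto intro!: continuous_intros)

lemma admissible_heat_kernel_dt: "admissible heat_kernel_dt"
  unfolding heat_kernel_dt_def by (intro admissible_sum admissible_heat_kernel_d2)

section \<open>Derivatives and mass of the heat kernel\<close>

lemma norm_sq_add_axis:
  fixes z :: "real ^ 'n"
  shows "(norm (z + s *\<^sub>R axis i 1))\<^sup>2 = (norm z)\<^sup>2 + 2 * s * z $ i + s\<^sup>2"
  unfolding power2_norm_eq_inner
  by (simp add: inner_add_left inner_add_right inner_axis inner_axis' power2_eq_square algebra_simps)

lemma heat_kernel_partial_deriv:
  fixes z :: "real ^ 'n"
  assumes "0 < t"
  shows "((\<lambda>s. heat_kernel t (z + s *\<^sub>R axis i 1)) has_real_derivative heat_kernel_d i t z) (at 0)"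
  unfolding heat_kernel_def heat_kernel_d_def norm_sq_add_axis
  by (rule derivative_eq_intros refl | use assms in \<open>simp add: field_simps\<close>)+

lemma heat_kernel_partial_deriv2:
  fixes z :: "real ^ 'n"
  assumes "0 < t"
  shows "((\<lambda>s. heat_kernel_d j t (z + s *\<^sub>R axis i 1)) has_real_derivative heat_kernel_d2 i j t z) (at 0)"
proof -
  have "((\<lambda>s. - (1 / (2 * t)) * ((z $ j + s * axis i 1 $ j) * heat_kernel t (z + s *\<^sub>R axis i 1)))
    has_real_derivative - (1 / (2 * t)) * (axis i 1 $ j * heat_kernel t z + z $ j * heat_kernel_d i t z)) (at 0)"
    by (rule derivative_eq_intros heat_kernel_partial_deriv[OF assms] refl | simp)+
  moreover have "- (1 / (2 * t)) * (axis i 1 $ j * heat_kernel t z + z $ j * heat_kernel_d i t z) = heat_kernel_d2 i j t z"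
    using assms by (simp add: heat_kernel_d2_def heat_kernel_d_def axis_def field_simps power2_eq_square)
  ultimately show ?thesis
    by (simp add: heat_kernel_d_def)
qed

text \<open>This is the heat equation for the kernel: the squares of the coordinates in the diagonal
  second derivatives add up to the squared norm, and the result is the logarithmic time derivative
  times the kernel.\<close>

lemma heat_kernel_time_deriv:
  fixes z :: "real ^ 'n"
  assumes "0 < t"
  shows "((\<lambda>s. heat_kernel s z) has_real_derivative heat_kernel_dt t z) (at t)"
proof -
  have "heat_kernel_dt t z = heat_kernel t z * ((norm z)\<^sup>2 / (4 * t\<^sup>2) - real CARD('n) / (2 * t))"
  proof -
    have "(norm z)\<^sup>2 = (\<Sum>i\<in>UNIV. z $ i * z $ i)"
      by (simp add: power2_norm_eq_inner inner_vec_def)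
    then show ?thesis
      unfolding heat_kernel_dt_def heat_kernel_d2_def
      by (simp add: sum.distrib sum_distrib_left sum_distrib_right sum_divide_distrib sum_subtractf algebra_simps)
  qed
  moreover have "((\<lambda>s. heat_kernel s z) has_real_derivative
      heat_kernel t z * ((norm z)\<^sup>2 / (4 * t\<^sup>2) - real CARD('n) / (2 * t))) (at t)"
    unfolding heat_kernel_def
    by (rule derivative_eq_intros refl | use assms in \<open>simp add: field_simps power2_eq_square\<close>)+
  ultimately show ?thesis by simp
qed

text \<open>The kernel is the product over the coordinates of centred normal densities with variance
  \<open>2 * t\<close>, each of mass 1.\<close>

lemma nn_integral_heat_kernel:
  assumes t: "0 < t"
  shows "(\<integral>\<^sup>+z. ennreal (heat_kernel t (z :: real ^ 'n)) \<partial>lborel) = 1"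
proof -
  let ?f = "normal_density 0 (sqrt (2 * t))"
  have "heat_kernel t z = (\<Prod>b\<in>Basis. ?f (z \<bullet> b))" for z :: "real ^ 'n"
  proof -
    have "(\<Prod>b\<in>Basis. ?f (z \<bullet> b)) = (\<Prod>i\<in>UNIV. ?f (z $ i))"
      by (simp add: Basis_vec_def cart_eq_inner_axis axis_eq_axis prod.UNION_disjoint)
    also have "\<dots> = (1 / sqrt (4 * pi * t)) ^ CARD('n) * exp (\<Sum>i\<in>UNIV. - (z $ i)\<^sup>2 / (4 * t))"
      using t unfolding exp_sum[OF finite] prod_constant[symmetric] prod.distrib[symmetric]
      by (intro prod.cong) (simp_all add: normal_density_def mult.commute)
    also have "(\<Sum>i\<in>UNIV. - (z $ i)\<^sup>2 / (4 * t)) = - (norm z / sqrt t)\<^sup>2 / 4"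
    proof -
      have "(norm z)\<^sup>2 = (\<Sum>i\<in>UNIV. (z $ i)\<^sup>2)"
        unfolding power2_norm_eq_inner inner_vec_def by (simp add: power2_eq_square)
      then show ?thesis
        using t by (simp add: power_divide sum_divide_distrib sum_negf mult.commute)
    qed
    finally show ?thesis
      using heat_kernel_eq[OF t, of z] by simp
  qed
  then have "(\<integral>\<^sup>+z. ennreal (heat_kernel t (z :: real ^ 'n)) \<partial>lborel) = (\<integral>\<^sup>+z. (\<Prod>b\<in>Basis. ennreal (?f ((z :: real ^ 'n) \<bullet> b))) \<partial>lborel)"
    by (simp add: prod_ennreal)
  also have "\<dots> = (\<Prod>b\<in>(Basis :: (real ^ 'n) set). \<integral>\<^sup>+x. ennreal (?f x) \<partial>lborel)"
    by (rule nn_integral_lborel_prod) auto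
  also have "(\<integral>\<^sup>+x. ennreal (?f x) \<partial>lborel) = 1"
    using t by (subst nn_integral_eq_integral) auto
  finally show ?thesis by simp
qed

text \<open>A space derivative costs a factor \<open>1 / sqrt t\<close> and one power of the
  scale-free variable, which the Gaussian decay absorbs later.\<close>

lemma heat_kernel_d_le:
  fixes z :: "real ^ 'n"
  assumes t: "0 < t"
  shows "\<bar>heat_kernel_d i t z\<bar> \<le> 1 / sqrt t * (heat_kernel t z * (1 + norm z / sqrt t) ^ 1)"
proof -
  define s where "s = norm z / sqrt t"
  have zi: "\<bar>z $ i\<bar> \<le> s * sqrt t"
    using component_le_norm_cart[of z i] t by (simp add: s_def)
  have s: "0 \<le> s" using t by (simp add: s_def)
  have "\<bar>z $ i\<bar> / (2 * t) \<le> s * sqrt t / (2 * (sqrt t * sqrt t))"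
    using zi t by (simp add: divide_right_mono)
  also have "\<dots> = 1 / sqrt t * (s / 2)"
    using t by (simp add: field_simps del: real_sqrt_mult_self)
  also have "\<dots> \<le> 1 / sqrt t * (1 + s)"
    using s t by (intro mult_left_mono) auto
  finally have "\<bar>z $ i\<bar> / (2 * t) * heat_kernel t z \<le> 1 / sqrt t * (1 + s) * heat_kernel t z"
    using heat_kernel_pos[of t z] by (intro mult_right_mono) auto
  moreover have "\<bar>heat_kernel_d i t z\<bar> = \<bar>z $ i\<bar> / (2 * t) * heat_kernel t z"
    using t heat_kernel_pos[of t z] by (simp add: heat_kernel_d_def abs_mult)
  ultimately show ?thesis
    by (simp add: s_def mult_ac)
qed

lemma heat_kernel_d2_le:
  fixes z :: "real ^ 'n"
  assumes t: "0 < t"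
  shows "\<bar>heat_kernel_d2 i j t z\<bar> \<le> 1 / t * (heat_kernel t z * (1 + norm z / sqrt t) ^ 2)"
proof -
  define s where "s = norm z / sqrt t"
  have s: "0 \<le> s" using t by (simp add: s_def)
  have zi: "\<bar>z $ i\<bar> \<le> s * sqrt t" for i
    using component_le_norm_cart[of z i] t by (simp add: s_def)
  have "\<bar>z $ i\<bar> * \<bar>z $ j\<bar> \<le> (s * sqrt t) * (s * sqrt t)"
    using s t by (intro mult_mono zi) auto
  also have "\<dots> = s\<^sup>2 * t"
    using t by (simp add: power2_eq_square)
  finally have "\<bar>z $ i\<bar> * \<bar>z $ j\<bar> / (4 * t\<^sup>2) \<le> s\<^sup>2 * t / (4 * t\<^sup>2)"
    by (intro divide_right_mono) auto
  also have "\<dots> = 1 / t * (s\<^sup>2 / 4)"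
    using t by (simp add: power2_eq_square)
  finally have "\<bar>z $ i * z $ j / (4 * t\<^sup>2)\<bar> \<le> 1 / t * (s\<^sup>2 / 4)"
    by (simp add: abs_mult)
  moreover have "\<bar>- (if i = j then 1 else 0) / (2 * t)\<bar> \<le> 1 / t * (1 / 2)"
    using t by (simp add: field_simps)
  ultimately have "\<bar>z $ i * z $ j / (4 * t\<^sup>2) + - (if i = j then 1 else 0) / (2 * t)\<bar> \<le> 1 / t * (s\<^sup>2 / 4) + 1 / t * (1 / 2)"
    by linarith
  also have "\<dots> = 1 / t * (s\<^sup>2 / 4 + 1 / 2)"
    by (rule distrib_left[symmetric])
  also have "\<dots> \<le> 1 / t * (1 + s) ^ 2"
  proof (rule mult_left_mono)
    show "s\<^sup>2 / 4 + 1 / 2 \<le> (1 + s)\<^sup>2"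
      unfolding power2_sum one_power2 using s zero_le_power2[of s] by linarith
  qed (use t in simp)
  finally have "\<bar>z $ i * z $ j / (4 * t\<^sup>2) + - (if i = j then 1 else 0) / (2 * t)\<bar> * heat_kernel t z \<le> 1 / t * (1 + s) ^ 2 * heat_kernel t z"
    using heat_kernel_pos[of t z] by (intro mult_right_mono) auto
  moreover have "heat_kernel_d2 i j t z = (z $ i * z $ j / (4 * t\<^sup>2) + - (if i = j then 1 else 0) / (2 * t)) * heat_kernel t z"
    by (simp add: heat_kernel_d2_def algebra_simps)
  ultimately show ?thesis
    using heat_kernel_pos[of t z] by (simp add: s_def mult_ac abs_mult)
qed

text \<open>The decay is applied with the exponent raised by \<open>2 * CARD('n) + 2\<close>; the
  extra powers are spent on the weight. The factorials in the final constant arise here.\<close>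

lemma heat_kernel_le_weight:
  fixes z :: "real ^ 'n"
  assumes t: "0 < t"
  shows "heat_kernel t z * (1 + norm z / sqrt t) ^ M
    \<le> fact (M + (2 * CARD('n) + 2)) * exp 2 / sqrt t ^ CARD('n) * weight (sqrt t) z"
proof -
  have p: "0 < 1 + norm z / sqrt t"
    using t by (intro add_pos_nonneg) auto
  have "heat_kernel t z * (1 + norm z / sqrt t) ^ M * (1 + norm z / sqrt t) ^ (2 * CARD('n) + 2) \<le> fact (M + (2 * CARD('n) + 2)) * exp 2 / sqrt t ^ CARD('n)"
    using heat_kernel_decay[OF t, of z "M + (2 * CARD('n) + 2)"] by (simp only: power_add[of _ M] mult.assoc)
  then show ?thesis
    unfolding weight_def using p by (simp only: pos_le_divide_eq zero_less_power times_divide_eq_right mult_1_right)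
qed

section \<open>Convolutions with functions of bounded mean oscillation\<close>

abbreviation weight_sum :: real where
  "weight_sum \<equiv> (\<Sum>k. 1 / real (Suc k) ^ 2)"

lemma weight_sum_nonneg: "0 \<le> weight_sum"
  using inverse_squares_sums by (intro suminf_nonneg) (auto simp: sums_iff)

lemma nn_integral_weight:
  fixes x :: "real ^ 'n"
  assumes r: "0 < r"
  shows "(\<integral>\<^sup>+y. ennreal (weight r (x - y)) \<partial>lborel) \<le> ennreal ((2 * r) ^ CARD('n) * weight_sum)"
proof -
  have "(\<integral>\<^sup>+y. ennreal (weight r (x - y)) * 1 \<partial>lborel) \<le> ennreal ((2 * r) ^ CARD('n) * weight_sum)"
  proof (rule nn_integral_weight_le[OF _ r])
    fix k :: nat assume k: "1 \<le> k"
    have "real k ^ CARD('n) \<le> real k ^ (2 * CARD('n))"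
      using k by (intro power_increasing) auto
    then have "(2 * real k * r) ^ CARD('n) \<le> (2 * r) ^ CARD('n) * real k ^ (2 * CARD('n))"
      using r by (simp add: power_mult_distrib mult_left_mono)
    then show "(\<integral>\<^sup>+y\<in>cube (\<chi> i. x $ i - real k * r) (2 * real k * r). 1 \<partial>lborel) \<le> ennreal ((2 * r) ^ CARD('n) * real k ^ (2 * CARD('n)))"
      using r k emeasure_cube[of "2 * real k * r" "\<chi> i. x $ i - real k * r"]
      by (simp add: ennreal_leI del: vec_lambda_beta)
  qed (use r in auto)
  then show ?thesis by simp
qed

lemma weighted_integrable_const: "weighted_integrable (\<lambda>_ :: real ^ 'n. c)"
proof
  fix x :: "real ^ 'n"
  have "(\<integral>\<^sup>+y. ennreal (norm (weight 1 (x - y))) \<partial>lborel) < \<infinity>"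
    using nn_integral_weight[of 1 x] by (simp add: weight_nonneg order_le_less_trans[OF _ ennreal_less_top])
  then have "integrable lborel (\<lambda>y. weight 1 (x - y))"
    by (intro integrableI_bounded) auto
  then show "integrable lborel (\<lambda>y. weight 1 (x - y) * \<bar>c\<bar>)"
    by (rule integrable_mult_left)
qed auto

lemma convolve_heat_kernel_const:
  assumes t: "0 < t"
  shows "convolve heat_kernel (\<lambda>_. 1) t (x :: real ^ 'n) = 1"
proof -
  note [measurable] = admissible_borel[OF admissible_heat_kernel t]
  have "convolve heat_kernel (\<lambda>_. 1) t x = (\<integral>y. heat_kernel t (x - y) \<partial>lborel)"
    by (simp add: convolve_def)
  also have "\<dots> = (\<integral>y. heat_kernel t (y :: real ^ 'n) \<partial>lborel)"
    by (rule integral_lborel_reflect) measurable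
  also have "\<dots> = enn2real (\<integral>\<^sup>+y. ennreal (heat_kernel t (y :: real ^ 'n)) \<partial>lborel)"
    by (rule integral_eq_nn_integral) (auto intro!: AE_I2 less_imp_le heat_kernel_pos)
  finally show ?thesis
    by (simp add: nn_integral_heat_kernel[OF t])
qed

lemma convolve_heat_kernel_d_const:
  fixes x :: "real ^ 'n"
  assumes t: "0 < t"
  shows "convolve (heat_kernel_d i) (\<lambda>_. 1) t x = 0"
proof -
  interpret weighted_integrable "\<lambda>_ :: real ^ 'n. 1 :: real"
    by (rule weighted_integrable_const)
  have "((\<lambda>s. convolve heat_kernel (\<lambda>_. 1) t (x + s *\<^sub>R axis i 1)) has_real_derivative convolve (heat_kernel_d i) (\<lambda>_. 1) t x) (at 0)"
    using t by (intro convolve_has_partial_derivative admissible_heat_kernel admissible_heat_kernel_d heat_kernel_partial_deriv)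
  then have "((\<lambda>s. 1) has_real_derivative convolve (heat_kernel_d i) (\<lambda>_. 1) t x) (at 0)"
    by (simp add: convolve_heat_kernel_const[OF t])
  then show ?thesis
    using DERIV_unique DERIV_const by blast
qed

lemma convolve_heat_kernel_d2_const:
  fixes x :: "real ^ 'n"
  assumes t: "0 < t"
  shows "convolve (heat_kernel_d2 i j) (\<lambda>_. 1) t x = 0"
proof -
  interpret weighted_integrable "\<lambda>_ :: real ^ 'n. 1 :: real"
    by (rule weighted_integrable_const)
  have "((\<lambda>s. convolve (heat_kernel_d j) (\<lambda>_. 1) t (x + s *\<^sub>R axis i 1)) has_real_derivative convolve (heat_kernel_d2 i j) (\<lambda>_. 1) t x) (at 0)"
    using t by (intro convolve_has_partial_derivative admissible_heat_kernel_d admissible_heat_kernel_d2 heat_kernel_partial_deriv2)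
  then have "((\<lambda>s. 0) has_real_derivative convolve (heat_kernel_d2 i j) (\<lambda>_. 1) t x) (at 0)"
    by (simp add: convolve_heat_kernel_d_const[OF t])
  then show ?thesis
    using DERIV_unique DERIV_const by blast
qed

text \<open>Tonelli's theorem, in the form shared by the large-cube bound, the oscillation bound and
  the initial value; these differ only in the choice of \<open>h\<close> and
  \<open>\<Phi>\<close>.\<close>

lemma nn_integral_heat_kernel_swap_le:
  fixes h :: "real ^ 'n \<Rightarrow> real ^ 'n \<Rightarrow> ennreal"
  assumes t: "0 < t" and [measurable]: "(\<lambda>(x, y). h x y) \<in> borel_measurable (lborel \<Otimes>\<^sub>M lborel)" "Q \<in> sets borel"
    and h: "\<And>y. (\<integral>\<^sup>+x\<in>Q. h x y \<partial>lborel) \<le> \<Phi> y"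
  shows "(\<integral>\<^sup>+x\<in>Q. (\<integral>\<^sup>+y. ennreal (heat_kernel t y) * h x y \<partial>lborel) \<partial>lborel) \<le> (\<integral>\<^sup>+y. ennreal (heat_kernel t y) * \<Phi> y \<partial>lborel)"
proof -
  note [measurable] = admissible_borel[OF admissible_heat_kernel t]
  have "(\<integral>\<^sup>+x\<in>Q. (\<integral>\<^sup>+y. ennreal (heat_kernel t y) * h x y \<partial>lborel) \<partial>lborel)
      = (\<integral>\<^sup>+x. (\<integral>\<^sup>+y. ennreal (heat_kernel t y) * (h x y * indicator Q x) \<partial>lborel) \<partial>lborel)"
    by (intro nn_integral_cong) (auto split: split_indicator)
  also have "\<dots> = (\<integral>\<^sup>+y. (\<integral>\<^sup>+x. ennreal (heat_kernel t y) * (h x y * indicator Q x) \<partial>lborel) \<partial>lborel)"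
    by (rule lborel_pair.Fubini'[symmetric]) measurable
  also have "\<dots> = (\<integral>\<^sup>+y. ennreal (heat_kernel t y) * (\<integral>\<^sup>+x\<in>Q. h x y \<partial>lborel) \<partial>lborel)"
    by (intro nn_integral_cong nn_integral_cmult) measurable
  also have "\<dots> \<le> (\<integral>\<^sup>+y. ennreal (heat_kernel t y) * \<Phi> y \<partial>lborel)"
    by (intro nn_integral_mono mult_left_mono h) auto
  finally show ?thesis .
qed

lemma nn_integral_heat_kernel_const:
  assumes t: "0 < t"
  shows "(\<integral>\<^sup>+y. ennreal (heat_kernel t (y :: real ^ 'n)) * D \<partial>lborel) = D"
proof -
  note [measurable] = admissible_borel[OF admissible_heat_kernel t]
  show ?thesis
    by (subst nn_integral_multc) (auto simp: nn_integral_heat_kernel[OF t])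
qed

text \<open>The form in which the norm is used: \<open>a\<close> stands for the bmo norm, and a
  single oscillation condition with an unspecified constant covers all side lengths.\<close>

locale bmo_function =
  fixes v :: "real ^ 'n \<Rightarrow> real" and a :: real
  assumes v_borel [measurable]: "v \<in> borel_measurable borel"
    and a_nonneg: "0 \<le> a"
    and oscillation: "\<And>p l. 0 < l \<Longrightarrow> \<exists>c. (\<integral>\<^sup>+x\<in>cube p l. ennreal \<bar>v x - c\<bar> \<partial>lborel) \<le> ennreal (a * l ^ CARD('n))"
    and large_cube: "\<And>p l. 1 < l \<Longrightarrow> (\<integral>\<^sup>+x\<in>cube p l. ennreal \<bar>v x\<bar> \<partial>lborel) \<le> ennreal (a * l ^ CARD('n))"
begin

text \<open>At scale \<open>r = 1\<close> every cube in the sum has side at least 2, so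
  \<open>large_cube\<close> applies to each of them. This makes all the convolutions with
  \<open>v\<close> converge.\<close>

lemma nn_integral_weight_abs:
  "(\<integral>\<^sup>+y. ennreal (weight 1 (x - y)) * ennreal \<bar>v y\<bar> \<partial>lborel) \<le> ennreal (a * 2 ^ CARD('n) * weight_sum)"
proof (rule nn_integral_weight_le)
  fix k :: nat assume k: "1 \<le> k"
  have "real k ^ CARD('n) \<le> real k ^ (2 * CARD('n))"
    using k by (intro power_increasing) auto
  then have "a * (2 * real k) ^ CARD('n) \<le> a * 2 ^ CARD('n) * real k ^ (2 * CARD('n))"
    using a_nonneg by (simp add: power_mult_distrib mult_left_mono mult.assoc)
  then show "(\<integral>\<^sup>+y\<in>cube (\<chi> i. x $ i - real k * 1) (2 * real k * 1). ennreal \<bar>v y\<bar> \<partial>lborel) \<le> ennreal (a * 2 ^ CARD('n) * real k ^ (2 * CARD('n)))"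
    using k by (intro order_trans[OF large_cube] ennreal_leI) auto
qed (use a_nonneg in auto)

sublocale weighted_integrable v
proof
  fix x
  have e: "(\<integral>\<^sup>+y. ennreal (weight 1 (x - y)) * ennreal \<bar>v y\<bar> \<partial>lborel) = (\<integral>\<^sup>+y. ennreal (norm (weight 1 (x - y) * \<bar>v y\<bar>)) \<partial>lborel)"
    by (intro nn_integral_cong) (simp add: ennreal_mult'' weight_nonneg abs_mult)
  have "(\<integral>\<^sup>+y. ennreal (norm (weight 1 (x - y) * \<bar>v y\<bar>)) \<partial>lborel) < \<infinity>"
    using nn_integral_weight_abs[of x] unfolding e by (rule order_le_less_trans) simp
  then show "integrable lborel (\<lambda>y. weight 1 (x - y) * \<bar>v y\<bar>)"
    by (intro integrableI_bounded) measurable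
qed auto

text \<open>The constant is compared with that of the smallest cube in one step; the resulting factor
  \<open>k ^ CARD('n)\<close> is absorbed by the weight, so no telescoping over dyadic cubes is needed.\<close>

lemma nn_integral_weight_oscillation:
  assumes r: "0 < r"
  obtains c where "(\<integral>\<^sup>+y. ennreal (weight r (x - y)) * ennreal \<bar>v y - c\<bar> \<partial>lborel)
    \<le> ennreal (3 * a * (2 * r) ^ CARD('n) * weight_sum)"
proof -
  let ?Q = "\<lambda>k::nat. cube (\<chi> i. x $ i - real k * r) (2 * real k * r)"
  \<comment> \<open>The condition on \<open>k\<close> stands inside the existential so that
    \<open>choice\<close> yields a total function; for \<open>k = 0\<close> the cube degenerates and
    no bound is claimed.\<close>
  have "\<forall>k. \<exists>c. 1 \<le> k \<longrightarrow>
      (\<integral>\<^sup>+y\<in>?Q k. ennreal \<bar>v y - c\<bar> \<partial>lborel) \<le> ennreal (a * (2 * real k * r) ^ CARD('n))"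
  proof
    fix k :: nat
    have "1 \<le> k \<longrightarrow> 0 < 2 * real k * r"
      using r by auto
    then show "\<exists>c. 1 \<le> k \<longrightarrow>
      (\<integral>\<^sup>+y\<in>?Q k. ennreal \<bar>v y - c\<bar> \<partial>lborel) \<le> ennreal (a * (2 * real k * r) ^ CARD('n))"
      using oscillation[of "2 * real k * r" "\<chi> i. x $ i - real k * r"] by blast
  qed
  from choice[OF this] obtain c where c: "\<And>k. 1 \<le> k \<Longrightarrow>
      (\<integral>\<^sup>+y\<in>?Q k. ennreal \<bar>v y - c k\<bar> \<partial>lborel) \<le> ennreal (a * (2 * real k * r) ^ CARD('n))"
    by blast
  have tri: "(\<integral>\<^sup>+y\<in>A. ennreal \<bar>g y - b2\<bar> \<partial>lborel) \<le> (\<integral>\<^sup>+y\<in>A. ennreal \<bar>g y - b1\<bar> \<partial>lborel) + (\<integral>\<^sup>+y\<in>A. ennreal \<bar>b1 - b2\<bar> \<partial>lborel)"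
    if [measurable]: "g \<in> borel_measurable borel" "A \<in> sets borel" for g and A :: "(real ^ 'n) set" and b1 b2 :: real
    using ennreal_abs_triangle[of _ b2 b1]
    by (subst nn_integral_add[symmetric]) (auto intro!: nn_integral_mono split: split_indicator simp del: ennreal_plus)
  have "(\<integral>\<^sup>+y. ennreal (weight r (x - y)) * ennreal \<bar>v y - c 1\<bar> \<partial>lborel) \<le> ennreal (3 * a * (2 * r) ^ CARD('n) * weight_sum)"
  proof (rule nn_integral_weight_le[OF _ r])
    fix k :: nat assume k: "1 \<le> k"
    define K where "K = real k ^ CARD('n)"
    define R where "R = (2 * r) ^ CARD('n)"
    have K1: "1 \<le> K" using k by (simp add: K_def one_le_power)
    have R0: "0 < R" using r by (simp add: R_def)
    have side: "(2 * real k * r) ^ CARD('n) = K * R"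
      by (simp add: K_def R_def power_mult_distrib)
    have ck: "(\<integral>\<^sup>+y\<in>?Q k. ennreal \<bar>v y - c k\<bar> \<partial>lborel) \<le> ennreal (a * (K * R))"
      using c[OF k] side by simp
    have "?Q 1 \<subseteq> ?Q k"
    proof
      fix y assume y: "y \<in> ?Q 1"
      have "1 * r \<le> real k * r" using k r by (intro mult_right_mono) auto
      then have "x $ i - real k * r \<le> y $ i \<and> y $ i \<le> x $ i + real k * r" for i
        using y[unfolded mem_cube, rule_format, of i] by simp
      then show "y \<in> ?Q k"
        unfolding mem_cube by (auto simp: algebra_simps)
    qed
    then have sub: "(\<integral>\<^sup>+y\<in>?Q 1. ennreal \<bar>v y - c k\<bar> \<partial>lborel) \<le> ennreal (a * (K * R))"
      by (intro order_trans[OF _ ck] nn_integral_mono) (auto split: split_indicator)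
    \<comment> \<open>Both constants are compared with \<open>v\<close> on the smallest cube. There
      the deviation from \<open>c k\<close> is bounded by its integral over all of
      \<open>?Q k\<close>, which is where the factor \<open>K\<close> is lost.\<close>
    have "ennreal (\<bar>c k - c 1\<bar> * R) = (\<integral>\<^sup>+y\<in>?Q 1. ennreal \<bar>c k - c 1\<bar> \<partial>lborel)"
      using nn_integral_const_cube[of "2 * r" "\<bar>c k - c 1\<bar>" "\<chi> i. x $ i - r"] r by (simp add: R_def)
    also have "\<dots> \<le> (\<integral>\<^sup>+y\<in>?Q 1. ennreal \<bar>v y - c k\<bar> + ennreal \<bar>v y - c 1\<bar> \<partial>lborel)"
    proof (intro nn_integral_mono mult_right_mono)
      fix y
      show "ennreal \<bar>c k - c 1\<bar> \<le> ennreal \<bar>v y - c k\<bar> + ennreal \<bar>v y - c 1\<bar>"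
        using ennreal_abs_triangle[of "c k" "c 1" "v y"] by (simp only: abs_minus_commute[of "v y" "c k"])
    qed auto
    also have "\<dots> = (\<integral>\<^sup>+y\<in>?Q 1. ennreal \<bar>v y - c k\<bar> \<partial>lborel) + (\<integral>\<^sup>+y\<in>?Q 1. ennreal \<bar>v y - c 1\<bar> \<partial>lborel)"
      by (subst nn_integral_add[symmetric]) (auto simp: distrib_right)
    also have "\<dots> \<le> ennreal (a * (K * R)) + ennreal (a * R)"
      using sub c[of 1] by (intro add_mono) (auto simp: R_def)
    also have "\<dots> = ennreal (a * (K + 1) * R)"
      using a_nonneg K1 R0 by (subst ennreal_plus[symmetric]) (auto simp: algebra_simps)
    finally have ck1: "\<bar>c k - c 1\<bar> \<le> a * (K + 1)"
      using a_nonneg K1 R0 by (subst (asm) ennreal_le_iff) auto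
    have "(\<integral>\<^sup>+y\<in>?Q k. ennreal \<bar>v y - c 1\<bar> \<partial>lborel) \<le> ennreal (a * (K * R)) + ennreal (\<bar>c k - c 1\<bar> * (K * R))"
      using nn_integral_const_cube[of "2 * real k * r" "\<bar>c k - c 1\<bar>" "\<chi> i. x $ i - real k * r"] r
      by (intro order_trans[OF tri[of v _ _ "c k"]] add_mono ck) (auto simp: side)
    also have "\<dots> \<le> ennreal (3 * a * R * (K * K))"
    proof -
      have "a * (K * R) + \<bar>c k - c 1\<bar> * (K * R) \<le> a * (K * R) + a * (K + 1) * (K * R)"
        using ck1 K1 R0 by (intro add_left_mono mult_right_mono) auto
      also have "\<dots> = a * (R * K) * (K + 2)"
        by (simp add: algebra_simps)
      \<comment> \<open>Origin of the factor 3: \<open>K + 2 \<le> 3 * K\<close> because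
        \<open>K \<ge> 1\<close>.\<close>
      also have "\<dots> \<le> a * (R * K) * (3 * K)"
        using K1 R0 a_nonneg by (intro mult_left_mono) auto
      also have "\<dots> = 3 * a * R * (K * K)"
        by simp
      finally have "ennreal (a * (K * R) + \<bar>c k - c 1\<bar> * (K * R)) \<le> ennreal (3 * a * R * (K * K))"
        by (rule ennreal_leI)
      then show ?thesis
        using a_nonneg K1 R0 by (subst (asm) ennreal_plus) auto
    qed
    also have "K * K = real k ^ (2 * CARD('n))"
      by (simp add: K_def power_add[symmetric] mult_2)
    finally show "(\<integral>\<^sup>+y\<in>?Q k. ennreal \<bar>v y - c 1\<bar> \<partial>lborel) \<le> ennreal (3 * a * (2 * r) ^ CARD('n) * real k ^ (2 * CARD('n)))"
      by (simp add: R_def)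
  qed (use a_nonneg r in auto)
  then show thesis by (rule that)
qed

text \<open>The power of \<open>sqrt t\<close> below \<open>B\<close> cancels against the volume of
  the cube of side \<open>2 * sqrt t\<close> in the oscillation bound. What depends on
  \<open>t\<close> is then contained in \<open>B\<close>, namely \<open>1 / sqrt t\<close> for first
  and \<open>1 / t\<close> for second derivatives.\<close>

lemma convolve_cancel_bound:
  assumes K: "admissible K" and t: "0 < t" and const: "convolve K (\<lambda>_. 1) t x = 0"
    and bound: "\<And>z. \<bar>K t z\<bar> \<le> B / sqrt t ^ CARD('n) * weight (sqrt t) z" and B: "0 \<le> B"
  shows "\<bar>convolve K v t x\<bar> \<le> B * 3 * 2 ^ CARD('n) * weight_sum * a"
proof -
  obtain c where c: "(\<integral>\<^sup>+y. ennreal (weight (sqrt t) (x - y)) * ennreal \<bar>v y - c\<bar> \<partial>lborel)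
    \<le> ennreal (3 * a * (2 * sqrt t) ^ CARD('n) * weight_sum)"
    using nn_integral_weight_oscillation[of "sqrt t" x] t by auto
  interpret one: weighted_integrable "\<lambda>_ :: real ^ 'n. 1 :: real"
    by (rule weighted_integrable_const)
  note [measurable] = admissible_borel[OF K t]
  have i1: "integrable lborel (\<lambda>y. K t (x - y) * v y)"
    by (rule convolve_integrable[OF K t])
  have i2: "integrable lborel (\<lambda>y. c * (K t (x - y) * 1))"
    by (intro integrable_mult_right one.convolve_integrable[OF K t])
  have "convolve K v t x = convolve K v t x - c * convolve K (\<lambda>_. 1) t x"
    using const by simp
  also have "\<dots> = (\<integral>y. K t (x - y) * v y - c * (K t (x - y) * 1) \<partial>lborel)"
    unfolding convolve_def by (subst Bochner_Integration.integral_diff[OF i1 i2]) simp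
  also have "\<dots> = (\<integral>y. K t (x - y) * (v y - c) \<partial>lborel)"
    by (simp add: algebra_simps)
  finally have eq: "convolve K v t x = (\<integral>y. K t (x - y) * (v y - c) \<partial>lborel)" .
  have i3: "integrable lborel (\<lambda>y. K t (x - y) * (v y - c))"
    using Bochner_Integration.integrable_diff[OF i1 i2] by (simp add: algebra_simps)
  have "ennreal \<bar>convolve K v t x\<bar> \<le> (\<integral>\<^sup>+y. ennreal (norm (K t (x - y) * (v y - c))) \<partial>lborel)"
    unfolding eq real_norm_def[symmetric] by (rule integral_norm_bound_ennreal[OF i3])
  also have "\<dots> \<le> (\<integral>\<^sup>+y. ennreal (B / sqrt t ^ CARD('n)) * (ennreal (weight (sqrt t) (x - y)) * ennreal \<bar>v y - c\<bar>) \<partial>lborel)"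
  proof (intro nn_integral_mono)
    fix y
    have "norm (K t (x - y) * (v y - c)) \<le> (B / sqrt t ^ CARD('n) * weight (sqrt t) (x - y)) * \<bar>v y - c\<bar>"
      unfolding real_norm_def abs_mult by (intro mult_right_mono bound) auto
    then show "ennreal (norm (K t (x - y) * (v y - c))) \<le> ennreal (B / sqrt t ^ CARD('n)) * (ennreal (weight (sqrt t) (x - y)) * ennreal \<bar>v y - c\<bar>)"
      using B t by (simp add: ennreal_mult[symmetric] weight_nonneg ennreal_leI mult.assoc)
  qed
  also have "\<dots> = ennreal (B / sqrt t ^ CARD('n)) * (\<integral>\<^sup>+y. ennreal (weight (sqrt t) (x - y)) * ennreal \<bar>v y - c\<bar> \<partial>lborel)"
    by (rule nn_integral_cmult) measurable
  also have "\<dots> \<le> ennreal (B / sqrt t ^ CARD('n)) * ennreal (3 * a * (2 * sqrt t) ^ CARD('n) * weight_sum)"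
    by (intro mult_left_mono c) auto
  also have "\<dots> = ennreal (B * 3 * 2 ^ CARD('n) * weight_sum * a)"
    using B t a_nonneg weight_sum_nonneg
    by (subst ennreal_mult[symmetric]) (auto intro!: arg_cong[of _ _ ennreal] simp: power_mult_distrib field_simps)
  finally show ?thesis
    using B a_nonneg weight_sum_nonneg by (subst (asm) ennreal_le_iff) auto
qed

section \<open>The heat extension and its derivatives\<close>

definition heat_ext :: "real \<Rightarrow> real ^ 'n \<Rightarrow> real" where
  "heat_ext t x = convolve heat_kernel v t x"

lemma heat_ext_partial:
  assumes "0 < t"
  shows "((\<lambda>s. heat_ext t (x + s *\<^sub>R axis i 1)) has_real_derivative convolve (heat_kernel_d i) v t x) (at 0)"
  unfolding heat_ext_def using assms
  by (intro convolve_has_partial_derivative admissible_heat_kernel admissible_heat_kernel_d heat_kernel_partial_deriv)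

lemma heat_ext_partial2:
  assumes "0 < t"
  shows "((\<lambda>s. convolve (heat_kernel_d j) v t (x + s *\<^sub>R axis i 1)) has_real_derivative convolve (heat_kernel_d2 i j) v t x) (at 0)"
  using assms
  by (intro convolve_has_partial_derivative admissible_heat_kernel_d admissible_heat_kernel_d2 heat_kernel_partial_deriv2)

lemma heat_ext_time:
  assumes "0 < t"
  shows "((\<lambda>s. heat_ext s x) has_real_derivative convolve heat_kernel_dt v t x) (at t)"
  unfolding heat_ext_def using assms
  by (intro convolve_has_time_derivative admissible_heat_kernel admissible_heat_kernel_dt heat_kernel_time_deriv)

lemma convolve_dt:
  assumes "0 < t"
  shows "convolve heat_kernel_dt v t x = (\<Sum>i\<in>UNIV. convolve (heat_kernel_d2 i i) v t x)"
  unfolding convolve_def heat_kernel_dt_def sum_distrib_right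
  by (rule Bochner_Integration.integral_sum) (rule convolve_integrable[OF admissible_heat_kernel_d2 assms])

lemma convolve_d_bound:
  assumes t: "0 < t"
  shows "sqrt t * \<bar>convolve (heat_kernel_d i) v t x\<bar> \<le> fact (1 + (2 * CARD('n) + 2)) * exp 2 * 3 * 2 ^ CARD('n) * weight_sum * a"
proof -
  have "\<bar>convolve (heat_kernel_d i) v t x\<bar> \<le> (1 / sqrt t * (fact (1 + (2 * CARD('n) + 2)) * exp 2)) * 3 * 2 ^ CARD('n) * weight_sum * a"
  proof (rule convolve_cancel_bound[OF admissible_heat_kernel_d t convolve_heat_kernel_d_const[OF t]])
    fix z :: "real ^ 'n"
    have "1 / sqrt t * (heat_kernel t z * (1 + norm z / sqrt t) ^ 1)
        \<le> 1 / sqrt t * (fact (1 + (2 * CARD('n) + 2)) * exp 2 / sqrt t ^ CARD('n) * weight (sqrt t) z)"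
      using t by (intro mult_left_mono heat_kernel_le_weight) auto
    then show "\<bar>heat_kernel_d i t z\<bar> \<le> 1 / sqrt t * (fact (1 + (2 * CARD('n) + 2)) * exp 2) / sqrt t ^ CARD('n) * weight (sqrt t) z"
      using heat_kernel_d_le[OF t, of i z] by simp
  qed (use t in auto)
  then have "sqrt t * \<bar>convolve (heat_kernel_d i) v t x\<bar> \<le> sqrt t * ((1 / sqrt t * (fact (1 + (2 * CARD('n) + 2)) * exp 2)) * 3 * 2 ^ CARD('n) * weight_sum * a)"
    using t by (intro mult_left_mono) auto
  then show ?thesis
    using t by simp
qed

lemma convolve_d2_bound:
  assumes t: "0 < t"
  shows "t * \<bar>convolve (heat_kernel_d2 i j) v t x\<bar> \<le> fact (2 + (2 * CARD('n) + 2)) * exp 2 * 3 * 2 ^ CARD('n) * weight_sum * a"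
proof -
  have "\<bar>convolve (heat_kernel_d2 i j) v t x\<bar> \<le> (1 / t * (fact (2 + (2 * CARD('n) + 2)) * exp 2)) * 3 * 2 ^ CARD('n) * weight_sum * a"
  proof (rule convolve_cancel_bound[OF admissible_heat_kernel_d2 t convolve_heat_kernel_d2_const[OF t]])
    fix z :: "real ^ 'n"
    have "1 / t * (heat_kernel t z * (1 + norm z / sqrt t) ^ 2)
        \<le> 1 / t * (fact (2 + (2 * CARD('n) + 2)) * exp 2 / sqrt t ^ CARD('n) * weight (sqrt t) z)"
      using t by (intro mult_left_mono heat_kernel_le_weight) auto
    then show "\<bar>heat_kernel_d2 i j t z\<bar> \<le> 1 / t * (fact (2 + (2 * CARD('n) + 2)) * exp 2) / sqrt t ^ CARD('n) * weight (sqrt t) z"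
      using heat_kernel_d2_le[OF t, of i j z] by simp
  qed (use t in auto)
  then have "t * \<bar>convolve (heat_kernel_d2 i j) v t x\<bar> \<le> t * ((1 / t * (fact (2 + (2 * CARD('n) + 2)) * exp 2)) * 3 * 2 ^ CARD('n) * weight_sum * a)"
    using t by (intro mult_left_mono) auto
  then show ?thesis
    using t by simp
qed

end

section \<open>Translations and the initial value\<close>

text \<open>Measurable functions are almost everywhere limits of continuous ones, but such a
  sequence need not have an integrable majorant. Hence \<open>v\<close> is truncated at a high level
  \<open>M\<close> and the approximants at the same level; on the set \<open>S\<close> of finite
  measure the constant \<open>2 * M\<close> then dominates.\<close>

lemma exists_continuous_L1_approx:
  fixes v :: "real ^ 'n \<Rightarrow> real"
  assumes [measurable]: "v \<in> borel_measurable borel"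
    and S: "compact S" and fin: "(\<integral>\<^sup>+x\<in>S. ennreal \<bar>v x\<bar> \<partial>lborel) < \<infinity>" and e: "0 < (e :: real)"
  obtains g where "continuous_on UNIV g" "(\<integral>\<^sup>+x\<in>S. ennreal \<bar>v x - g x\<bar> \<partial>lborel) \<le> ennreal e"
proof -
  have [measurable]: "S \<in> sets borel"
    using S by (simp add: compact_imp_closed)
  have finS: "emeasure lborel S < \<infinity>"
    using S emeasure_compact_finite by auto
  define clamp where "clamp M y = max (- M) (min M y)" for M y :: real
  have clamp_cont: "continuous_on UNIV (clamp M)" for M
    unfolding clamp_def[abs_def] by (intro continuous_intros)
  have [measurable]: "clamp M \<in> borel_measurable borel" for M
    using clamp_cont by (rule borel_measurable_continuous_onI)
  have "(\<lambda>n. \<integral>\<^sup>+x\<in>S. ennreal \<bar>v x - clamp (real n) (v x)\<bar> \<partial>lborel) \<longlonglongrightarrow> (\<integral>\<^sup>+x\<in>S. 0 \<partial>lborel)"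
  proof (rule nn_integral_dominated_convergence[where w="\<lambda>x. ennreal \<bar>v x\<bar> * indicator S x"])
    show "AE x in lborel. (\<lambda>n. ennreal \<bar>v x - clamp (real n) (v x)\<bar> * indicator S x) \<longlonglongrightarrow> 0 * indicator S x"
    proof (intro AE_I2)
      fix x
      have "eventually (\<lambda>n. ennreal \<bar>v x - clamp (real n) (v x)\<bar> * indicator S x = 0 * indicator S x) sequentially"
        using eventually_ge_at_top[of "nat \<lceil>\<bar>v x\<bar>\<rceil>"]
      proof eventually_elim
        case (elim n)
        then have "\<bar>v x\<bar> \<le> real n" by linarith
        then have "clamp (real n) (v x) = v x" by (auto simp: clamp_def)
        then show ?case by simp
      qed
      then show "(\<lambda>n. ennreal \<bar>v x - clamp (real n) (v x)\<bar> * indicator S x) \<longlonglongrightarrow> 0 * indicator S x"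
        by (rule tendsto_eventually)
    qed
    show "AE x in lborel. ennreal \<bar>v x - clamp (real n) (v x)\<bar> * indicator S x \<le> ennreal \<bar>v x\<bar> * indicator S x" for n
      by (intro AE_I2 mult_right_mono ennreal_leI) (auto simp: clamp_def)
  qed (use fin in auto)
  then have "eventually (\<lambda>n. (\<integral>\<^sup>+x\<in>S. ennreal \<bar>v x - clamp (real n) (v x)\<bar> \<partial>lborel) < ennreal (e / 2)) sequentially"
    using e by (intro order_tendstoD(2)) auto
  then obtain n where n: "(\<integral>\<^sup>+x\<in>S. ennreal \<bar>v x - clamp (real n) (v x)\<bar> \<partial>lborel) < ennreal (e / 2)"
    by (meson eventually_sequentially order_refl)
  define M where "M = real n"
  have "v \<in> borel_measurable (lebesgue_on UNIV)"
    using measurable_completion[of v lborel borel] by (simp add: lebesgue_on_UNIV_eq)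
  then have "v measurable_on UNIV"
    by (intro lebesgue_measurable_imp_measurable_on) auto
  then obtain Z g where Z: "negligible Z" and g: "\<And>k. continuous_on UNIV (g k)"
    and lim: "\<And>x. x \<notin> Z \<Longrightarrow> (\<lambda>k. g k x) \<longlonglongrightarrow> v x"
    unfolding measurable_on_def by auto
  have [measurable]: "g k \<in> borel_measurable borel" for k
    using g by (rule borel_measurable_continuous_onI)
  have Z': "AE x in lebesgue. x \<notin> Z"
    using Z by (simp add: negligible_iff_null_sets AE_not_in)
  have ae: "AE x in lborel. (\<lambda>k. g k x) \<longlonglongrightarrow> v x"
  proof -
    have "AE x in lebesgue. (\<lambda>k. g k x) \<longlonglongrightarrow> v x"
      using Z' by eventually_elim (rule lim)
    then show ?thesis
      by (simp add: AE_completion_iff)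
  qed
  have "(\<lambda>k. \<integral>\<^sup>+x\<in>S. ennreal \<bar>clamp M (v x) - clamp M (g k x)\<bar> \<partial>lborel) \<longlonglongrightarrow> (\<integral>\<^sup>+x\<in>S. 0 \<partial>lborel)"
  proof (rule nn_integral_dominated_convergence[where w="\<lambda>x. ennreal (2 * M) * indicator S x"])
    show "AE x in lborel. (\<lambda>k. ennreal \<bar>clamp M (v x) - clamp M (g k x)\<bar> * indicator S x) \<longlonglongrightarrow> 0 * indicator S x"
      using ae
    proof eventually_elim
      case (elim x)
      have "(\<lambda>k. clamp M (g k x)) \<longlonglongrightarrow> clamp M (v x)"
        by (rule continuous_on_tendsto_compose[OF clamp_cont elim]) auto
      then have "(\<lambda>k. ennreal \<bar>clamp M (v x) - clamp M (g k x)\<bar>) \<longlonglongrightarrow> ennreal \<bar>clamp M (v x) - clamp M (v x)\<bar>"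
        by (intro tendsto_intros)
      then show ?case
        by (auto split: split_indicator)
    qed
    show "AE x in lborel. ennreal \<bar>clamp M (v x) - clamp M (g k x)\<bar> * indicator S x \<le> ennreal (2 * M) * indicator S x" for k
      by (intro AE_I2 mult_right_mono ennreal_leI) (auto simp: clamp_def M_def)
    show "(\<integral>\<^sup>+x. ennreal (2 * M) * indicator S x \<partial>lborel) < \<infinity>"
      using finS by (simp add: nn_integral_cmult_indicator ennreal_mult_less_top)
  qed auto
  then have "eventually (\<lambda>k. (\<integral>\<^sup>+x\<in>S. ennreal \<bar>clamp M (v x) - clamp M (g k x)\<bar> \<partial>lborel) < ennreal (e / 2)) sequentially"
    using e by (intro order_tendstoD(2)) auto
  then obtain k where k: "(\<integral>\<^sup>+x\<in>S. ennreal \<bar>clamp M (v x) - clamp M (g k x)\<bar> \<partial>lborel) < ennreal (e / 2)"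
    by (meson eventually_sequentially order_refl)
  show thesis
  proof
    show "continuous_on UNIV (\<lambda>x. clamp M (g k x))"
      by (rule continuous_on_compose2[OF clamp_cont g]) auto
    have "(\<integral>\<^sup>+x\<in>S. ennreal \<bar>v x - clamp M (g k x)\<bar> \<partial>lborel)
      \<le> (\<integral>\<^sup>+x. ennreal \<bar>v x - clamp M (v x)\<bar> * indicator S x + ennreal \<bar>clamp M (v x) - clamp M (g k x)\<bar> * indicator S x \<partial>lborel)"
      using ennreal_abs_triangle
      by (intro nn_integral_mono) (auto split: split_indicator simp del: ennreal_plus)
    also have "\<dots> = (\<integral>\<^sup>+x\<in>S. ennreal \<bar>v x - clamp M (v x)\<bar> \<partial>lborel) + (\<integral>\<^sup>+x\<in>S. ennreal \<bar>clamp M (v x) - clamp M (g k x)\<bar> \<partial>lborel)"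
      by (rule nn_integral_add) auto
    also have "\<dots> \<le> ennreal (e / 2) + ennreal (e / 2)"
      using n k by (intro add_mono) (auto simp: M_def less_imp_le)
    also have "\<dots> = ennreal e"
      using e by (subst ennreal_plus[symmetric]) auto
    finally show "(\<integral>\<^sup>+x\<in>S. ennreal \<bar>v x - clamp M (g k x)\<bar> \<partial>lborel) \<le> ennreal e" .
  qed
qed

text \<open>Three errors of size \<open>e / 3\<close>: replacing \<open>v\<close> by a continuous
  \<open>g\<close> before and after the shift, and shifting \<open>g\<close>, which is uniformly
  continuous on a compact set containing all the shifted points.\<close>

lemma translation_continuous_L1:
  fixes v :: "real ^ 'n \<Rightarrow> real"
  assumes [measurable]: "v \<in> borel_measurable borel" and K: "compact K"
    and fin: "\<And>S. compact S \<Longrightarrow> (\<integral>\<^sup>+x\<in>S. ennreal \<bar>v x\<bar> \<partial>lborel) < \<infinity>" and e: "0 < (e :: real)"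
  obtains d where "0 < d" "\<And>y. norm y < d \<Longrightarrow> (\<integral>\<^sup>+x\<in>K. ennreal \<bar>v (x - y) - v x\<bar> \<partial>lborel) \<le> ennreal e"
proof -
  define S where "S = (\<lambda>p. fst p - snd p) ` (K \<times> cball 0 1)"
  have S: "compact S"
    unfolding S_def using K
    by (intro compact_continuous_image compact_Times compact_cball) (auto intro!: continuous_intros)
  have KS: "x - y \<in> S" if "x \<in> K" "norm y \<le> 1" for x y
    using that unfolding S_def by (intro image_eqI[of _ _ "(x, y)"]) auto
  have [measurable]: "S \<in> sets borel" "K \<in> sets borel"
    using S K by (auto simp: compact_imp_closed)
  obtain g where g: "continuous_on UNIV g" and ge: "(\<integral>\<^sup>+x\<in>S. ennreal \<bar>v x - g x\<bar> \<partial>lborel) \<le> ennreal (e / 3)"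
    using exists_continuous_L1_approx[of v S "e / 3"] fin[OF S] S e by auto
  have [measurable]: "g \<in> borel_measurable borel"
    using g by (rule borel_measurable_continuous_onI)
  have finK: "emeasure lborel K < \<infinity>"
    using K emeasure_compact_finite by auto
  define m where "m = measure lborel K"
  have m: "emeasure lborel K = ennreal m" "0 \<le> m"
    using finK by (auto simp: m_def emeasure_eq_ennreal_measure)
  \<comment> \<open>The denominator has \<open>m + 1\<close> instead of \<open>m\<close> so that it
    stays positive when \<open>K\<close> is a null set.\<close>
  define e' where "e' = e / (3 * (m + 1))"
  have e': "0 < e'" using e m by (simp add: e'_def)
  have "uniformly_continuous_on S g"
    by (intro compact_uniformly_continuous continuous_on_subset[OF g] S) auto
  then obtain d where d: "0 < d" "\<And>x x'. x \<in> S \<Longrightarrow> x' \<in> S \<Longrightarrow> dist x' x < d \<Longrightarrow> dist (g x') (g x) < e'"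
    using e' unfolding uniformly_continuous_on_def by metis
  show thesis
  proof
    show "0 < min d 1" using d by simp
    fix y :: "real ^ 'n" assume y: "norm y < min d 1"
    have vy [measurable]: "(\<lambda>x. v (x - y)) \<in> borel_measurable borel" "(\<lambda>x. g (x - y)) \<in> borel_measurable borel"
      by measurable
    have 1: "(\<integral>\<^sup>+x\<in>K. ennreal \<bar>v (x - y) - g (x - y)\<bar> \<partial>lborel) \<le> ennreal (e / 3)"
    proof -
      have "(\<integral>\<^sup>+x\<in>K. ennreal \<bar>v (x - y) - g (x - y)\<bar> \<partial>lborel) \<le> (\<integral>\<^sup>+x. ennreal \<bar>v (- y + x) - g (- y + x)\<bar> * indicator S (- y + x) \<partial>lborel)"
        using KS y by (intro nn_integral_mono) (auto split: split_indicator)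
      also have "\<dots> = (\<integral>\<^sup>+x\<in>S. ennreal \<bar>v x - g x\<bar> \<partial>lborel)"
        by (rule nn_integral_lborel_translate) measurable
      finally show ?thesis using ge by simp
    qed
    have 2: "(\<integral>\<^sup>+x\<in>K. ennreal \<bar>g (x - y) - g x\<bar> \<partial>lborel) \<le> ennreal (e / 3)"
    proof -
      have "(\<integral>\<^sup>+x\<in>K. ennreal \<bar>g (x - y) - g x\<bar> \<partial>lborel) \<le> (\<integral>\<^sup>+x\<in>K. ennreal e' \<partial>lborel)"
      proof (intro nn_integral_mono)
        fix x
        have "\<bar>g (x - y) - g x\<bar> < e'" if "x \<in> K"
          using d(2)[of x "x - y"] KS[of x 0] KS[of x y] that y by (auto simp: dist_norm)
        then show "ennreal \<bar>g (x - y) - g x\<bar> * indicator K x \<le> ennreal e' * indicator K x"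
          by (auto split: split_indicator intro!: ennreal_leI simp: less_imp_le)
      qed
      also have "\<dots> = ennreal (e' * m)"
        using e' m by (simp add: nn_integral_cmult_indicator ennreal_mult)
      also have "e' * m \<le> e / 3"
        using e m by (simp add: e'_def field_simps)
      finally show ?thesis by (simp add: ennreal_leI)
    qed
    have 3: "(\<integral>\<^sup>+x\<in>K. ennreal \<bar>g x - v x\<bar> \<partial>lborel) \<le> ennreal (e / 3)"
    proof -
      have "(\<integral>\<^sup>+x\<in>K. ennreal \<bar>g x - v x\<bar> \<partial>lborel) \<le> (\<integral>\<^sup>+x\<in>S. ennreal \<bar>v x - g x\<bar> \<partial>lborel)"
        using KS[of _ 0] by (intro nn_integral_mono) (auto split: split_indicator simp: abs_minus_commute)
      then show ?thesis using ge by simp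
    qed
    have "(\<integral>\<^sup>+x\<in>K. ennreal \<bar>v (x - y) - v x\<bar> \<partial>lborel)
      \<le> (\<integral>\<^sup>+x. ennreal \<bar>v (x - y) - g (x - y)\<bar> * indicator K x
          + (ennreal \<bar>g (x - y) - g x\<bar> * indicator K x + ennreal \<bar>g x - v x\<bar> * indicator K x) \<partial>lborel)"
    proof (intro nn_integral_mono)
      fix x
      show "ennreal \<bar>v (x - y) - v x\<bar> * indicator K x \<le> ennreal \<bar>v (x - y) - g (x - y)\<bar> * indicator K x
          + (ennreal \<bar>g (x - y) - g x\<bar> * indicator K x + ennreal \<bar>g x - v x\<bar> * indicator K x)"
        using order_trans[OF ennreal_abs_triangle[of "v (x - y)" "v x" "g (x - y)"]
            add_left_mono[OF ennreal_abs_triangle[of "g (x - y)" "v x" "g x"]]]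
        by (auto split: split_indicator simp del: ennreal_plus)
    qed
    also have "\<dots> = (\<integral>\<^sup>+x\<in>K. ennreal \<bar>v (x - y) - g (x - y)\<bar> \<partial>lborel)
        + ((\<integral>\<^sup>+x\<in>K. ennreal \<bar>g (x - y) - g x\<bar> \<partial>lborel) + (\<integral>\<^sup>+x\<in>K. ennreal \<bar>g x - v x\<bar> \<partial>lborel))"
      by (subst nn_integral_add, measurable)+ 
    also have "\<dots> \<le> ennreal (e / 3) + (ennreal (e / 3) + ennreal (e / 3))"
      by (intro add_mono 1 2 3)
    also have "\<dots> = ennreal e"
      using e by (subst ennreal_plus[symmetric], simp, simp)+ simp
    finally show "(\<integral>\<^sup>+x\<in>K. ennreal \<bar>v (x - y) - v x\<bar> \<partial>lborel) \<le> ennreal e" .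
  qed
qed

context bmo_function
begin

section \<open>Cube averages of the heat extension\<close>

lemma nn_integral_translated_cube:
  assumes [measurable]: "f \<in> borel_measurable borel"
  shows "(\<integral>\<^sup>+x\<in>cube p l. f (x - y) \<partial>lborel) = (\<integral>\<^sup>+x\<in>cube (p - y) l. f x \<partial>lborel)"
proof -
  have i: "indicator (cube p l) x = (indicator (cube (p - y) l) (- y + x) :: ennreal)" for x
  proof -
    have "x \<in> cube p l \<longleftrightarrow> - y + x \<in> cube (p - y) l"
      unfolding mem_cube by (auto simp: algebra_simps)
    then show ?thesis by (simp only: indicator_def)
  qed
  have "(\<integral>\<^sup>+x\<in>cube p l. f (x - y) \<partial>lborel) = (\<integral>\<^sup>+x. f (- y + x) * indicator (cube (p - y) l) (- y + x) \<partial>lborel)"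
    unfolding i by simp
  also have "\<dots> = (\<integral>\<^sup>+x\<in>cube (p - y) l. f x \<partial>lborel)"
    by (rule nn_integral_lborel_translate) measurable
  finally show ?thesis .
qed

text \<open>The translation is moved onto \<open>v\<close>. For fixed \<open>y\<close>, integrating
  in \<open>x\<close> over a cube then means integrating \<open>v\<close> over a translated
  cube.\<close>

lemma heat_ext_reflect:
  assumes t: "0 < t"
  shows "heat_ext t x = (\<integral>y. heat_kernel t y * v (x - y) \<partial>lborel)"
    and "integrable lborel (\<lambda>y. heat_kernel t y * v (x - y))"
proof -
  note [measurable] = admissible_borel[OF admissible_heat_kernel t]
  have "(\<integral>y. (\<lambda>y. heat_kernel t (x - y) * v y) (x - y) \<partial>lborel) = (\<integral>y. heat_kernel t (x - y) * v y \<partial>lborel)"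
    by (rule integral_lborel_reflect) measurable
  then show "heat_ext t x = (\<integral>y. heat_kernel t y * v (x - y) \<partial>lborel)"
    by (simp add: heat_ext_def convolve_def)
  have "(\<integral>\<^sup>+y. (\<lambda>y. ennreal (norm (heat_kernel t (x - y) * v y))) (x - y) \<partial>lborel)
      = (\<integral>\<^sup>+y. ennreal (norm (heat_kernel t (x - y) * v y)) \<partial>lborel)"
    by (rule nn_integral_lborel_reflect) measurable
  also have "\<dots> < \<infinity>"
    using convolve_integrable[OF admissible_heat_kernel t, of x] unfolding integrable_iff_bounded by simp
  finally show "integrable lborel (\<lambda>y. heat_kernel t y * v (x - y))"
    by (intro integrableI_bounded) auto
qed

text \<open>The comparison value \<open>m y\<close> may vary with the translate \<open>y\<close>;
  boundedness makes it integrable against the kernel. It is used with 0, with the mean over a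
  translated cube, and with the fixed value \<open>v x\<close>.\<close>

lemma heat_ext_minus_average_le:
  assumes t: "0 < t" and m [measurable]: "m \<in> borel_measurable borel" and mB: "\<And>y. \<bar>m y\<bar> \<le> B"
  shows "ennreal \<bar>heat_ext t x - (\<integral>y. heat_kernel t y * m y \<partial>lborel)\<bar>
    \<le> (\<integral>\<^sup>+y. ennreal (heat_kernel t y) * ennreal \<bar>v (x - y) - m y\<bar> \<partial>lborel)"
proof -
  note [measurable] = admissible_borel[OF admissible_heat_kernel t]
  have "integrable lborel (\<lambda>y. heat_kernel t (y :: real ^ 'n))"
    using nn_integral_heat_kernel[OF t, where 'n='n]
    by (intro integrableI_bounded) (auto simp: heat_kernel_pos less_imp_le)
  then have i: "integrable lborel (\<lambda>y. heat_kernel t y * m y)"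
  proof (rule Bochner_Integration.integrable_bound[OF integrable_mult_left[of B]])
    show "AE y in lborel. norm (heat_kernel t y * m y) \<le> norm (heat_kernel t y * B)"
      using mB by (intro AE_I2) (auto simp: abs_mult intro!: mult_left_mono order_trans[OF mB])
  qed auto
  have i2: "integrable lborel (\<lambda>y. heat_kernel t y * v (x - y) - heat_kernel t y * m y)"
    by (intro Bochner_Integration.integrable_diff heat_ext_reflect[OF t] i)
  have "heat_ext t x - (\<integral>y. heat_kernel t y * m y \<partial>lborel) = (\<integral>y. heat_kernel t y * v (x - y) - heat_kernel t y * m y \<partial>lborel)"
    using heat_ext_reflect[OF t, of x] i by simp
  then have "ennreal \<bar>heat_ext t x - (\<integral>y. heat_kernel t y * m y \<partial>lborel)\<bar> \<le> (\<integral>\<^sup>+y. ennreal (norm (heat_kernel t y * v (x - y) - heat_kernel t y * m y)) \<partial>lborel)"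
    unfolding real_norm_def[symmetric] by (simp only: integral_norm_bound_ennreal[OF i2])
  also have "\<dots> = (\<integral>\<^sup>+y. ennreal (heat_kernel t y) * ennreal \<bar>v (x - y) - m y\<bar> \<partial>lborel)"
    by (intro nn_integral_cong)
      (simp add: right_diff_distrib[symmetric] abs_mult ennreal_mult abs_of_pos[OF heat_kernel_pos] less_imp_le[OF heat_kernel_pos])
  finally show ?thesis .
qed

lemma heat_ext_large_cube:
  assumes t: "0 < t" and l: "1 < l"
  shows "(\<integral>\<^sup>+x\<in>cube p l. ennreal \<bar>heat_ext t x\<bar> \<partial>lborel) \<le> ennreal (a * l ^ CARD('n))"
proof -
  have "(\<integral>\<^sup>+x\<in>cube p l. ennreal \<bar>heat_ext t x\<bar> \<partial>lborel)
      \<le> (\<integral>\<^sup>+x\<in>cube p l. (\<integral>\<^sup>+y. ennreal (heat_kernel t y) * ennreal \<bar>v (x - y)\<bar> \<partial>lborel) \<partial>lborel)"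
    using heat_ext_minus_average_le[OF t, of "\<lambda>_. 0" 0] by (intro nn_integral_mono mult_right_mono) auto
  also have "\<dots> \<le> (\<integral>\<^sup>+y. ennreal (heat_kernel t (y :: real ^ 'n)) * ennreal (a * l ^ CARD('n)) \<partial>lborel)"
  proof (rule nn_integral_heat_kernel_swap_le[OF t])
    fix y
    have "(\<integral>\<^sup>+x\<in>cube p l. ennreal \<bar>v (x - y)\<bar> \<partial>lborel) = (\<integral>\<^sup>+x\<in>cube (p - y) l. ennreal \<bar>v x\<bar> \<partial>lborel)"
      by (rule nn_integral_translated_cube) measurable
    also have "\<dots> \<le> ennreal (a * l ^ CARD('n))"
      by (rule large_cube[OF l])
    finally show "(\<integral>\<^sup>+x\<in>cube p l. ennreal \<bar>v (x - y)\<bar> \<partial>lborel) \<le> ennreal (a * l ^ CARD('n))" .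
  qed measurable
  finally show ?thesis
    by (simp add: nn_integral_heat_kernel_const[OF t])
qed

text \<open>The compact set lies in a cube of side above 1, and every translate of that cube obeys
  the same large-cube bound. The uniformity in \<open>y\<close> comes from the second half of the
  bmo norm.\<close>

lemma nn_integral_compact_le:
  assumes "compact K"
  obtains B where "0 \<le> B" "\<And>y. (\<integral>\<^sup>+x\<in>K. ennreal \<bar>v (x - y)\<bar> \<partial>lborel) \<le> ennreal B"
proof -
  obtain R0 where R0: "\<And>x. x \<in> K \<Longrightarrow> norm x \<le> R0"
    using compact_imp_bounded[OF assms] by (auto simp: bounded_iff)
  define R where "R = max R0 2"
  have R: "1 < R" "\<And>x. x \<in> K \<Longrightarrow> norm x \<le> R"
    using R0 by (force simp: R_def)+
  show thesis
  proof
    show "0 \<le> a * (2 * R) ^ CARD('n)" using R a_nonneg by simp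
    fix y
    have "K \<subseteq> cube (\<chi> i. - R) (2 * R)"
    proof
      fix x assume "x \<in> K"
      then have "\<bar>x $ i\<bar> \<le> R" for i
        using R(2)[of x] component_le_norm_cart[of x i] by simp
      then have "- R \<le> x $ i \<and> x $ i \<le> - R + 2 * R" for i
        by (simp add: abs_le_iff minus_le_iff)
      then show "x \<in> cube (\<chi> i. - R) (2 * R)"
        unfolding mem_cube by simp
    qed
    then have "(\<integral>\<^sup>+x\<in>K. ennreal \<bar>v (x - y)\<bar> \<partial>lborel) \<le> (\<integral>\<^sup>+x\<in>cube (\<chi> i. - R) (2 * R). ennreal \<bar>v (x - y)\<bar> \<partial>lborel)"
      by (intro nn_integral_mono mult_left_mono) (auto simp: indicator_def)
    also have "\<dots> = (\<integral>\<^sup>+x\<in>cube ((\<chi> i. - R) - y) (2 * R). ennreal \<bar>v x\<bar> \<partial>lborel)"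
      by (rule nn_integral_translated_cube) measurable
    also have "\<dots> \<le> ennreal (a * (2 * R) ^ CARD('n))"
      using R by (intro large_cube) auto
    finally show "(\<integral>\<^sup>+x\<in>K. ennreal \<bar>v (x - y)\<bar> \<partial>lborel) \<le> ennreal (a * (2 * R) ^ CARD('n))" .
  qed
qed

text \<open>The constant is the Gaussian average of the means \<open>m y\<close> of the translates.
  Arbitrary oscillation constants, chosen for each \<open>y\<close>, need not depend measurably on
  \<open>y\<close>; the means do, and using them costs the factor 2.\<close>

lemma heat_ext_oscillation:
  assumes t: "0 < t" and l: "0 < l"
  obtains c where "(\<integral>\<^sup>+x\<in>cube p l. ennreal \<bar>heat_ext t x - c\<bar> \<partial>lborel) \<le> ennreal (2 * a * l ^ CARD('n))"
proof -
  let ?Q = "cube p l"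
  obtain B where B: "0 \<le> B" "\<And>y. (\<integral>\<^sup>+x\<in>?Q. ennreal \<bar>v (x - y)\<bar> \<partial>lborel) \<le> ennreal B"
    by (rule nn_integral_compact_le[OF compact_cbox[of p "\<chi> i. p $ i + l"]]) (rule that)
  define m where "m y = (LINT x:?Q|lborel. v (x - y)) / l ^ CARD('n)" for y
  have [measurable]: "m \<in> borel_measurable borel"
    unfolding m_def set_lebesgue_integral_def by measurable
  have int: "set_integrable lborel ?Q (\<lambda>x. v (x - y))" for y
    unfolding set_integrable_def
  proof (rule integrableI_bounded)
    have "(\<integral>\<^sup>+x. ennreal (norm (indicator ?Q x *\<^sub>R v (x - y))) \<partial>lborel) = (\<integral>\<^sup>+x\<in>?Q. ennreal \<bar>v (x - y)\<bar> \<partial>lborel)"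
      by (intro nn_integral_cong) (auto split: split_indicator)
    then show "(\<integral>\<^sup>+x. ennreal (norm (indicator ?Q x *\<^sub>R v (x - y))) \<partial>lborel) < \<infinity>"
      using B(2)[of y] by (simp add: order_le_less_trans)
  qed measurable
  have mB: "\<bar>m y\<bar> \<le> B / l ^ CARD('n)" for y
  proof -
    have "ennreal (norm (LINT x:?Q|lborel. v (x - y))) \<le> (\<integral>\<^sup>+x. ennreal (norm (indicator ?Q x *\<^sub>R v (x - y))) \<partial>lborel)"
      unfolding set_lebesgue_integral_def using int[unfolded set_integrable_def] by (rule integral_norm_bound_ennreal)
    also have "\<dots> = (\<integral>\<^sup>+x\<in>?Q. ennreal \<bar>v (x - y)\<bar> \<partial>lborel)"
      by (intro nn_integral_cong) (auto split: split_indicator)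
    also have "\<dots> \<le> ennreal B"
      by (rule B(2))
    finally have "\<bar>LINT x:?Q|lborel. v (x - y)\<bar> \<le> B"
      using B(1) by (simp add: ennreal_le_iff)
    then show ?thesis
      using l by (simp add: m_def divide_right_mono)
  qed
  have osc: "(\<integral>\<^sup>+x\<in>?Q. ennreal \<bar>v (x - y) - m y\<bar> \<partial>lborel) \<le> ennreal (2 * a * l ^ CARD('n))" for y
  proof -
    obtain c where c: "(\<integral>\<^sup>+x\<in>cube (p - y) l. ennreal \<bar>v x - c\<bar> \<partial>lborel) \<le> ennreal (a * l ^ CARD('n))"
      using oscillation[OF l] by blast
    have "(\<integral>\<^sup>+x\<in>?Q. ennreal \<bar>v (x - y) - m y\<bar> \<partial>lborel) \<le> 2 * (\<integral>\<^sup>+x\<in>?Q. ennreal \<bar>v (x - y) - c\<bar> \<partial>lborel)"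
      unfolding m_def by (rule mean_oscillation_le[OF int l])
    also have "(\<integral>\<^sup>+x\<in>?Q. ennreal \<bar>v (x - y) - c\<bar> \<partial>lborel) = (\<integral>\<^sup>+x\<in>cube (p - y) l. ennreal \<bar>v x - c\<bar> \<partial>lborel)"
      by (rule nn_integral_translated_cube) measurable
    also have "2 * \<dots> \<le> 2 * ennreal (a * l ^ CARD('n))"
      using c by (rule mult_left_mono) simp
    also have "\<dots> = ennreal (2 * a * l ^ CARD('n))"
      using a_nonneg l by (simp add: ennreal_mult mult.assoc)
    finally show ?thesis .
  qed
  have "(\<integral>\<^sup>+x\<in>?Q. ennreal \<bar>heat_ext t x - (\<integral>y. heat_kernel t y * m y \<partial>lborel)\<bar> \<partial>lborel)
      \<le> (\<integral>\<^sup>+x\<in>?Q. (\<integral>\<^sup>+y. ennreal (heat_kernel t y) * ennreal \<bar>v (x - y) - m y\<bar> \<partial>lborel) \<partial>lborel)"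
    using mB by (intro nn_integral_mono mult_right_mono heat_ext_minus_average_le[OF t]) auto
  also have "\<dots> \<le> (\<integral>\<^sup>+y. ennreal (heat_kernel t (y :: real ^ 'n)) * ennreal (2 * a * l ^ CARD('n)) \<partial>lborel)"
    by (rule nn_integral_heat_kernel_swap_le[OF t _ _ osc]) measurable
  finally show thesis
    by (intro that) (simp add: nn_integral_heat_kernel_const[OF t])
qed

text \<open>The kernel is split at \<open>norm y = d\<close>. Inside, translations of
  \<open>v\<close> are close in \<open>L\<^sup>1\<close>-sense and the mass 1 preserves the
  smallness; outside, the kernel contributes only a multiple of \<open>sqrt t\<close>. The radius
  \<open>d\<close> is fixed before \<open>t\<close> tends to 0.\<close>

lemma heat_ext_initial:
  assumes K: "compact K"
  shows "((\<lambda>t. \<integral>\<^sup>+x\<in>K. ennreal \<bar>heat_ext t x - v x\<bar> \<partial>lborel) \<longlongrightarrow> 0) (at_right 0)"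
proof (rule order_tendstoI)
  fix e' :: ennreal assume "0 < e'"
  \<comment> \<open>The target \<open>e'\<close> may be infinite, so a strictly smaller, hence
    finite, positive bound is inserted.\<close>
  then obtain z where z: "0 < z" "z < e'"
    using dense by blast
  then obtain e where e: "0 < e" "ennreal e < e'"
    by (cases z) auto
  note [measurable] = borel_compact[OF K]
  obtain B where B: "0 \<le> B" "\<And>y. (\<integral>\<^sup>+x\<in>K. ennreal \<bar>v (x - y)\<bar> \<partial>lborel) \<le> ennreal B"
    by (rule nn_integral_compact_le[OF K]) (rule that)
  have fin: "(\<integral>\<^sup>+x\<in>S. ennreal \<bar>v x\<bar> \<partial>lborel) < \<infinity>" if S: "compact S" for S
  proof -
    obtain B where "\<And>y. (\<integral>\<^sup>+x\<in>S. ennreal \<bar>v (x - y)\<bar> \<partial>lborel) \<le> ennreal B"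
      using nn_integral_compact_le[OF S] by blast
    from this[of 0] show ?thesis
      by (simp add: order_le_less_trans)
  qed
  obtain d where d: "0 < d" "\<And>y. norm y < d \<Longrightarrow> (\<integral>\<^sup>+x\<in>K. ennreal \<bar>v (x - y) - v x\<bar> \<partial>lborel) \<le> ennreal (e / 2)"
    by (rule translation_continuous_L1[OF v_borel K fin half_gt_zero[OF e(1)]]) (assumption, rule that)
  define \<phi> where "\<phi> y = (\<integral>\<^sup>+x\<in>K. ennreal \<bar>v (x - y) - v x\<bar> \<partial>lborel)" for y
  have \<phi>B: "\<phi> y \<le> ennreal (2 * B)" for y
  proof -
    have "\<phi> y \<le> (\<integral>\<^sup>+x. ennreal \<bar>v (x - y)\<bar> * indicator K x + ennreal \<bar>v (x - 0)\<bar> * indicator K x \<partial>lborel)"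
      unfolding \<phi>_def using ennreal_abs_triangle[of "v (_ - y)" "v _" 0]
      by (intro nn_integral_mono) (auto split: split_indicator simp del: ennreal_plus)
    also have "\<dots> = (\<integral>\<^sup>+x\<in>K. ennreal \<bar>v (x - y)\<bar> \<partial>lborel) + (\<integral>\<^sup>+x\<in>K. ennreal \<bar>v (x - 0)\<bar> \<partial>lborel)"
      by (rule nn_integral_add) measurable
    also have "\<dots> \<le> ennreal B + ennreal B"
      by (intro add_mono B)
    also have "\<dots> = ennreal (2 * B)"
      using B by (subst ennreal_plus[symmetric]) auto
    finally show ?thesis .
  qed
  define F :: real where "F = fact (1 + (2 * CARD('n) + 2)) * exp 2"
  have F0: "0 \<le> F"
    by (simp add: F_def)
  define C where "C = F * 2 ^ CARD('n) * weight_sum * (2 * B) / d"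
  have C0: "0 \<le> C"
    using B d F0 weight_sum_nonneg by (simp add: C_def)
  have main: "(\<integral>\<^sup>+x\<in>K. ennreal \<bar>heat_ext t x - v x\<bar> \<partial>lborel) \<le> ennreal (e / 2 + C * sqrt t)" if t: "0 < t" for t
  proof -
    note [measurable] = admissible_borel[OF admissible_heat_kernel t]
    define D where "D = F / sqrt t ^ CARD('n) * (sqrt t / d) * (2 * B)"
    have D0: "0 \<le> D" using t d B F0 by (simp add: D_def)
    have kernel_split: "ennreal (heat_kernel t y) * \<phi> y \<le> ennreal (heat_kernel t y) * ennreal (e / 2) + ennreal D * ennreal (weight (sqrt t) (0 - y))" for y
    proof (cases "norm y < d")
      case True
      then have "ennreal (heat_kernel t y) * \<phi> y \<le> ennreal (heat_kernel t y) * ennreal (e / 2)"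
        unfolding \<phi>_def by (intro mult_left_mono d) auto
      then show ?thesis
        by (rule order_trans) simp
    next
      case False
      have s: "0 < sqrt t" using t by simp
      \<comment> \<open>Away from the ball this factor is at least 1. Inserting it gains
        \<open>sqrt t\<close> at the price of one more power in the Gaussian decay, which explains
        the 1 in the factorial of \<open>F\<close>.\<close>
      have "1 \<le> sqrt t / d * (1 + norm y / sqrt t)"
      proof -
        have "sqrt t / d * (1 + norm y / sqrt t) = (sqrt t + norm y) / d"
          using s by (simp add: distrib_left add_divide_distrib)
        moreover have "d \<le> sqrt t + norm y"
          using False s by linarith
        ultimately show ?thesis
          using d(1) by simp
      qed
      then have "heat_kernel t y * 1 \<le> heat_kernel t y * (sqrt t / d * (1 + norm y / sqrt t))"
        by (intro mult_left_mono less_imp_le[OF heat_kernel_pos])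
      also have "\<dots> = sqrt t / d * (heat_kernel t y * (1 + norm y / sqrt t) ^ 1)"
        by simp
      also have "\<dots> \<le> sqrt t / d * (F / sqrt t ^ CARD('n) * weight (sqrt t) y)"
        unfolding F_def using t d by (intro mult_left_mono heat_kernel_le_weight) auto
      finally have h: "heat_kernel t y \<le> sqrt t / d * (F / sqrt t ^ CARD('n) * weight (sqrt t) y)"
        by simp
      have "ennreal (heat_kernel t y) * \<phi> y \<le> ennreal (sqrt t / d * (F / sqrt t ^ CARD('n) * weight (sqrt t) y)) * ennreal (2 * B)"
        by (intro mult_mono ennreal_leI h \<phi>B) auto
      also have "\<dots> = ennreal (D * weight (sqrt t) y)"
        using B t d F0 by (subst ennreal_mult[symmetric]) (auto simp: D_def weight_nonneg mult_ac)
      also have "weight (sqrt t) y = weight (sqrt t) (0 - y)"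
        by (simp add: weight_def)
      also have "ennreal (D * weight (sqrt t) (0 - y)) = ennreal D * ennreal (weight (sqrt t) (0 - y))"
        using D0 t by (intro ennreal_mult) (auto simp: weight_nonneg)
      finally show ?thesis
        by (rule order_trans) simp
    qed
    have "(\<integral>\<^sup>+x\<in>K. ennreal \<bar>heat_ext t x - v x\<bar> \<partial>lborel)
        \<le> (\<integral>\<^sup>+x\<in>K. (\<integral>\<^sup>+y. ennreal (heat_kernel t y) * ennreal \<bar>v (x - y) - v x\<bar> \<partial>lborel) \<partial>lborel)"
    proof (intro nn_integral_mono mult_right_mono)
      fix x
      have "(\<integral>y. heat_kernel t (y :: real ^ 'n) * v x \<partial>lborel) = v x"
        using convolve_heat_kernel_const[OF t, of x] integral_lborel_reflect[of "heat_kernel t" x]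
        by (simp add: convolve_def)
      then show "ennreal \<bar>heat_ext t x - v x\<bar> \<le> (\<integral>\<^sup>+y. ennreal (heat_kernel t y) * ennreal \<bar>v (x - y) - v x\<bar> \<partial>lborel)"
        using heat_ext_minus_average_le[OF t, of "\<lambda>_. v x" "\<bar>v x\<bar>" x] by auto
    qed auto
    also have "\<dots> \<le> (\<integral>\<^sup>+y. ennreal (heat_kernel t y) * \<phi> y \<partial>lborel)"
      by (rule nn_integral_heat_kernel_swap_le[OF t]) (auto simp: \<phi>_def)
    also have "\<dots> \<le> (\<integral>\<^sup>+y. ennreal (heat_kernel t (y :: real ^ 'n)) * ennreal (e / 2) + ennreal D * ennreal (weight (sqrt t) (0 - y)) \<partial>lborel)"
      by (rule nn_integral_mono) (rule kernel_split)
    also have "\<dots> = (\<integral>\<^sup>+y. ennreal (heat_kernel t (y :: real ^ 'n)) * ennreal (e / 2) \<partial>lborel) + (\<integral>\<^sup>+y. ennreal D * ennreal (weight (sqrt t) (0 - (y :: real ^ 'n))) \<partial>lborel)"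
      by (rule nn_integral_add) measurable
    also have "(\<integral>\<^sup>+y. ennreal D * ennreal (weight (sqrt t) (0 - (y :: real ^ 'n))) \<partial>lborel) = ennreal D * (\<integral>\<^sup>+y. ennreal (weight (sqrt t) (0 - (y :: real ^ 'n))) \<partial>lborel)"
      by (rule nn_integral_cmult) measurable
    also have "\<dots> \<le> ennreal D * ennreal ((2 * sqrt t) ^ CARD('n) * weight_sum)"
      using t by (intro mult_left_mono nn_integral_weight) auto
    also have "\<dots> = ennreal (C * sqrt t)"
    proof -
      have "D * ((2 * sqrt t) ^ CARD('n) * weight_sum) = C * sqrt t"
        using t by (simp add: C_def D_def power_mult_distrib)
      then show ?thesis
        using D0 t weight_sum_nonneg by (subst ennreal_mult[symmetric]) auto
    qed
    finally show ?thesis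
      using e t C0 by (simp add: nn_integral_heat_kernel_const[OF t] add_left_mono)
  qed
  have "((\<lambda>t. e / 2 + C * sqrt t) \<longlongrightarrow> e / 2 + C * sqrt 0) (at_right 0)"
    by (intro tendsto_intros)
  then have "eventually (\<lambda>t. e / 2 + C * sqrt t < e) (at_right 0)"
    by (rule order_tendstoD) (use e in simp)
  then show "eventually (\<lambda>t. (\<integral>\<^sup>+x\<in>K. ennreal \<bar>heat_ext t x - v x\<bar> \<partial>lborel) < e') (at_right 0)"
    using eventually_at_right_less[of 0]
  proof eventually_elim
    case (elim t)
    have "(\<integral>\<^sup>+x\<in>K. ennreal \<bar>heat_ext t x - v x\<bar> \<partial>lborel) \<le> ennreal e"
      using main[of t] elim by (meson ennreal_leI less_imp_le order_trans)
    then show ?case using e(2) by simp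
  qed
qed simp

end

section \<open>The solution and its estimates\<close>

lemma emeasure_lebesgue_cube:
  fixes p :: "real ^ 'n"
  assumes "0 \<le> l"
  shows "emeasure lebesgue (cube p l) = ennreal (l ^ CARD('n))"
  using emeasure_cube[OF assms, of p] by simp

text \<open>Clears the \<open>ennreal\<close> quotient. One direction reads cube estimates off the
  norm of the data, the other assembles them into the norm of the extension.\<close>

lemma abs_avg_le_iff:
  fixes p :: "real ^ 'n"
  assumes l: "0 < l" and b: "0 \<le> b"
  shows "abs_avg (cube p l) f \<le> ennreal b \<longleftrightarrow>
    (\<integral>\<^sup>+x\<in>cube p l. ennreal \<bar>f x\<bar> \<partial>lebesgue) \<le> ennreal (b * l ^ CARD('n))"
proof -
  let ?X = "\<integral>\<^sup>+x\<in>cube p l. ennreal \<bar>f x\<bar> \<partial>lebesgue"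
  have k: "0 < l ^ CARD('n)" using l by simp
  have e: "emeasure lebesgue (cube p l) = ennreal (l ^ CARD('n))"
    using l by (intro emeasure_lebesgue_cube) simp
  show ?thesis
    unfolding abs_avg_def e
  proof
    assume "?X / ennreal (l ^ CARD('n)) \<le> ennreal b"
    then have *: "?X / ennreal (l ^ CARD('n)) * ennreal (l ^ CARD('n)) \<le> ennreal b * ennreal (l ^ CARD('n))"
      by (rule mult_right_mono) simp
    show "?X \<le> ennreal (b * l ^ CARD('n))"
    proof -
      have "ennreal (l ^ CARD('n)) / ennreal (l ^ CARD('n)) = 1"
        using l by (subst divide_ennreal) auto
      with * show ?thesis
        using k b by (simp add: ennreal_divide_times ennreal_mult)
    qed
  next
    assume "?X \<le> ennreal (b * l ^ CARD('n))"
    then show "?X / ennreal (l ^ CARD('n)) \<le> ennreal b"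
      using k b by (intro divide_le_posI_ennreal) (auto simp: ennreal_mult mult.commute)
  qed
qed

lemma cubesE:
  assumes "Q \<in> cubes"
  obtains p l where "Q = cube p l" "0 < l"
  using assms unfolding cubes_def by blast

lemma cube_in_cubes: "0 < l \<Longrightarrow> cube p l \<in> cubes"
  unfolding cubes_def by blast

lemma bmo_norm_le:
  fixes h :: "real ^ 'n \<Rightarrow> real"
  assumes b: "0 \<le> b1" "0 \<le> b2"
    and small: "\<And>p l. 0 < l \<Longrightarrow>
      (\<integral>\<^sup>+x\<in>cube p l. ennreal \<bar>h x - avg (cube p l) h\<bar> \<partial>lebesgue) \<le> ennreal (b1 * l ^ CARD('n))"
    and large: "\<And>p l. 1 < l \<Longrightarrow> (\<integral>\<^sup>+x\<in>cube p l. ennreal \<bar>h x\<bar> \<partial>lebesgue) \<le> ennreal (b2 * l ^ CARD('n))"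
  shows "bmo_norm h \<le> ennreal (b1 + b2)"
proof -
  have "(SUP Q\<in>{Q \<in> cubes. emeasure lebesgue Q \<le> 1}. abs_avg Q (\<lambda>x. h x - avg Q h)) \<le> ennreal b1"
  proof (rule SUP_least)
    fix Q :: "(real ^ 'n) set" assume "Q \<in> {Q \<in> cubes. emeasure lebesgue Q \<le> 1}"
    then obtain p l where Q: "Q = cube p l" "0 < l"
      by (auto elim: cubesE)
    show "abs_avg Q (\<lambda>x. h x - avg Q h) \<le> ennreal b1"
      unfolding Q(1) abs_avg_le_iff[OF Q(2) b(1)] by (rule small[OF Q(2)])
  qed
  moreover have "(SUP Q\<in>{Q \<in> cubes. 1 < emeasure lebesgue Q}. abs_avg Q h) \<le> ennreal b2"
  proof (rule SUP_least)
    fix Q :: "(real ^ 'n) set" assume "Q \<in> {Q \<in> cubes. 1 < emeasure lebesgue Q}"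
    then obtain p l where Q: "Q = cube p l" "0 < l" and m: "1 < emeasure lebesgue Q"
      by (auto elim: cubesE)
    have "1 < l ^ CARD('n)"
      using m emeasure_lebesgue_cube[of l p] Q by simp
    then have l: "1 < l"
      using Q(2) power_le_one[of l "CARD('n)"] by (meson less_imp_le not_less)
    show "abs_avg Q h \<le> ennreal b2"
      unfolding Q(1) abs_avg_le_iff[OF Q(2) b(2)] by (rule large[OF l])
  qed
  ultimately show ?thesis
    unfolding bmo_norm_def using b by (simp add: add_mono)
qed

lemma bmo_norm_small_cube:
  fixes h :: "real ^ 'n \<Rightarrow> real"
  assumes b: "0 \<le> b" "bmo_norm h \<le> ennreal b" and l: "0 < l" "l \<le> 1"
  shows "(\<integral>\<^sup>+x\<in>cube p l. ennreal \<bar>h x - avg (cube p l) h\<bar> \<partial>lebesgue) \<le> ennreal (b * l ^ CARD('n))"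
proof -
  have "emeasure lebesgue (cube p l) \<le> 1"
    using l emeasure_lebesgue_cube[of l p] by (simp add: power_le_one)
  then have "abs_avg (cube p l) (\<lambda>x. h x - avg (cube p l) h)
      \<le> (SUP Q\<in>{Q \<in> cubes. emeasure lebesgue Q \<le> 1}. abs_avg Q (\<lambda>x. h x - avg Q h))"
    using cube_in_cubes[OF l(1), of p] by (intro SUP_upper2[of "cube p l"]) auto
  also have "\<dots> \<le> bmo_norm h"
    unfolding bmo_norm_def by simp
  finally have "abs_avg (cube p l) (\<lambda>x. h x - avg (cube p l) h) \<le> ennreal b"
    using b(2) by (rule order_trans)
  then show ?thesis
    by (rule abs_avg_le_iff[OF l(1) b(1), THEN iffD1])
qed

lemma bmo_norm_large_cube:
  fixes h :: "real ^ 'n \<Rightarrow> real"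
  assumes b: "0 \<le> b" "bmo_norm h \<le> ennreal b" and l: "1 < l"
  shows "(\<integral>\<^sup>+x\<in>cube p l. ennreal \<bar>h x\<bar> \<partial>lebesgue) \<le> ennreal (b * l ^ CARD('n))"
proof -
  have l0: "0 < l" using l by simp
  have "emeasure lebesgue (cube p l) > 1"
    using l emeasure_lebesgue_cube[of l p] by (simp add: one_less_power)
  then have "abs_avg (cube p l) h \<le> (SUP Q\<in>{Q \<in> cubes. 1 < emeasure lebesgue Q}. abs_avg Q h)"
    using cube_in_cubes[OF l0, of p] by (intro SUP_upper2[of "cube p l"]) auto
  also have "\<dots> \<le> bmo_norm h"
    unfolding bmo_norm_def by simp
  finally have "abs_avg (cube p l) h \<le> ennreal b"
    using b(2) by (rule order_trans)
  then show ?thesis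
    by (rule abs_avg_le_iff[OF l0 b(1), THEN iffD1])
qed

text \<open>Integrability on compact sets gives measurability of the truncations to balls;
  \<open>h\<close> is their pointwise limit.\<close>

lemma locally_integrable_measurable:
  assumes "locally_integrable h"
  shows "h \<in> borel_measurable lebesgue"
proof (rule borel_measurable_LIMSEQ_real)
  fix k :: nat
  have "h absolutely_integrable_on cball 0 (real k)"
    using assms by (simp add: locally_integrable_def)
  then show "(\<lambda>x. indicator (cball 0 (real k)) x *\<^sub>R h x) \<in> borel_measurable lebesgue"
    unfolding set_integrable_def by (rule borel_measurable_integrable)
next
  fix x
  have "eventually (\<lambda>k. indicator (cball 0 (real k)) x *\<^sub>R h x = h x) sequentially"
    using eventually_ge_at_top[of "nat \<lceil>norm x\<rceil>"]
  proof eventually_elim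
    case (elim k)
    then have "norm x \<le> real k" by linarith
    then show ?case by simp
  qed
  then show "(\<lambda>k. indicator (cball 0 (real k)) x *\<^sub>R h x) \<longlonglongrightarrow> h x"
    by (rule tendsto_eventually)
qed

lemma bmo_borel_representative:
  fixes u0 :: "real ^ 'n \<Rightarrow> real"
  assumes u0: "u0 \<in> bmo"
  obtains v where "AE x in lborel. u0 x = v x" "bmo_function v (enn2real (bmo_norm u0))"
proof -
  define a where "a = enn2real (bmo_norm u0)"
  have a: "0 \<le> a" "bmo_norm u0 \<le> ennreal a"
    using u0 by (auto simp: a_def bmo_def)
  have "u0 \<in> borel_measurable lebesgue"
    using u0 by (intro locally_integrable_measurable) (simp add: bmo_def)
  then obtain v where v: "v \<in> borel_measurable lborel" and ae: "AE x in lborel. u0 x = v x"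
    using completion_ex_borel_measurable_real by blast
  have eq: "(\<integral>\<^sup>+x\<in>Q. ennreal \<bar>u0 x - c\<bar> \<partial>lebesgue) = (\<integral>\<^sup>+x\<in>Q. ennreal \<bar>v x - c\<bar> \<partial>lborel)" for Q c
    unfolding nn_integral_completion using ae by (intro nn_integral_cong_AE) auto
  have large: "(\<integral>\<^sup>+x\<in>cube p l. ennreal \<bar>v x\<bar> \<partial>lborel) \<le> ennreal (a * l ^ CARD('n))" if "1 < l" for p l
    using bmo_norm_large_cube[OF a that, of p] eq[where Q="cube p l" and c=0] by simp
  have "bmo_function v a"
  proof
    fix p :: "real ^ 'n" and l :: real assume l: "0 < l"
    show "\<exists>c. (\<integral>\<^sup>+x\<in>cube p l. ennreal \<bar>v x - c\<bar> \<partial>lborel) \<le> ennreal (a * l ^ CARD('n))"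
    proof (cases "l \<le> 1")
      case True
      then show ?thesis
        using bmo_norm_small_cube[OF a l True, of p] unfolding eq by blast
    next
      case False
      then show ?thesis
        using large[of l p] by (intro exI[of _ 0]) simp
    qed
  qed (use v a large in auto)
  with ae show thesis
    using that by (simp add: a_def)
qed

text \<open>Continuity provides the measurability that \<open>esssup_I\<close> asks for; the
  pointwise bound does the rest.\<close>

lemma Linf_norm_le:
  fixes g :: "real ^ 'n \<Rightarrow> 'b::real_normed_vector"
  assumes "continuous_on UNIV g" "\<And>x. norm (g x) \<le> B"
  shows "Linf_norm g \<le> ennreal B"
  unfolding Linf_norm_def
proof (rule esssup_I)
  have "continuous_on UNIV (\<lambda>x. norm (g x))"
    using assms(1) by (intro continuous_intros)
  then have "(\<lambda>x. norm (g x)) \<in> borel_measurable lebesgue"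
    by (intro measurable_completion) (simp add: borel_measurable_continuous_onI)
  then show "(\<lambda>x. ennreal (norm (g x))) \<in> borel_measurable lebesgue"
    by measurable
qed (use assms(2) in \<open>auto intro: ennreal_leI\<close>)

lemma scaled_Linf_norm_le:
  fixes g :: "real ^ 'n \<Rightarrow> 'b::real_normed_vector"
  assumes "continuous_on UNIV g" "0 < c" "\<And>x. c * norm (g x) \<le> B"
  shows "ennreal c * Linf_norm g \<le> ennreal B"
proof -
  have "Linf_norm g \<le> ennreal (B / c)"
    using assms by (intro Linf_norm_le) (auto simp: pos_le_divide_eq mult.commute)
  then have "ennreal c * Linf_norm g \<le> ennreal c * ennreal (B / c)"
    by (rule mult_left_mono) simp
  also have "\<dots> = ennreal B"
    using assms(2) order_trans[OF mult_nonneg_nonneg assms(3)]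
    by (subst ennreal_mult[symmetric]) auto
  finally show ?thesis .
qed

lemma continuous_on_slice:
  assumes "continuous_on ({0<..} \<times> UNIV) (\<lambda>(t :: real, x). f t x)" "0 < t"
  shows "continuous_on UNIV (f t)"
proof -
  have "continuous_on UNIV (\<lambda>x. (\<lambda>(t, x). f t x) (t, x))"
    by (rule continuous_on_compose2[OF assms(1)]) (use assms(2) in \<open>auto intro!: continuous_intros\<close>)
  then show ?thesis by simp
qed

context bmo_function
begin

section \<open>Norm estimates for the solution\<close>

lemma heat_ext_continuous: "0 < t \<Longrightarrow> continuous_on UNIV (heat_ext t)"
  using continuous_on_slice[OF convolve_continuous[OF admissible_heat_kernel]]
  by (simp add: heat_ext_def[abs_def])

text \<open>The 5 is \<open>4 + 1\<close>: oscillation \<open>2 * a\<close> about some constant,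
  doubled on passing to the mean, plus \<open>a\<close> for the large cubes.\<close>

lemma bmo_norm_heat_ext:
  assumes t: "0 < t"
  shows "bmo_norm (heat_ext t) \<le> ennreal (5 * a)"
proof -
  have [measurable]: "heat_ext t \<in> borel_measurable borel"
    using heat_ext_continuous[OF t] by (rule borel_measurable_continuous_onI)
  have "bmo_norm (heat_ext t) \<le> ennreal (4 * a + a)"
  proof (rule bmo_norm_le)
    fix p :: "real ^ 'n" and l :: real assume l: "0 < l"
    let ?Q = "cube p l"
    have int: "set_integrable lborel ?Q (heat_ext t)"
      unfolding set_integrable_def
      by (intro borel_integrable_compact compact_cbox continuous_on_subset[OF heat_ext_continuous[OF t]]) auto
    have "measure lebesgue ?Q = l ^ CARD('n)"
      using l emeasure_lebesgue_cube[of l p] by (simp add: measure_def)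
    moreover have "(LINT x:?Q|lebesgue. heat_ext t x) = (LINT x:?Q|lborel. heat_ext t x)"
      unfolding set_lebesgue_integral_def by (rule integral_completion) measurable
    ultimately have avg: "avg ?Q (heat_ext t) = (LINT x:?Q|lborel. heat_ext t x) / l ^ CARD('n)"
      by (simp add: avg_def)
    obtain c where c: "(\<integral>\<^sup>+x\<in>?Q. ennreal \<bar>heat_ext t x - c\<bar> \<partial>lborel) \<le> ennreal (2 * a * l ^ CARD('n))"
      using heat_ext_oscillation[OF t l] by blast
    have "(\<integral>\<^sup>+x\<in>?Q. ennreal \<bar>heat_ext t x - avg ?Q (heat_ext t)\<bar> \<partial>lebesgue)
        \<le> 2 * (\<integral>\<^sup>+x\<in>?Q. ennreal \<bar>heat_ext t x - c\<bar> \<partial>lborel)"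
      unfolding nn_integral_completion avg by (rule mean_oscillation_le[OF int l])
    also have "\<dots> \<le> 2 * ennreal (2 * a * l ^ CARD('n))"
      using c by (rule mult_left_mono) simp
    also have "\<dots> = ennreal (4 * a * l ^ CARD('n))"
    proof -
      have "2 * ennreal (2 * a * l ^ CARD('n)) = ennreal (2 * (2 * a * l ^ CARD('n)))"
        using a_nonneg l by (subst ennreal_mult) auto
      then show ?thesis by (simp add: mult.assoc)
    qed
    finally show "(\<integral>\<^sup>+x\<in>?Q. ennreal \<bar>heat_ext t x - avg ?Q (heat_ext t)\<bar> \<partial>lebesgue) \<le> ennreal (4 * a * l ^ CARD('n))" .
  next
    fix p :: "real ^ 'n" and l :: real assume l: "1 < l"
    show "(\<integral>\<^sup>+x\<in>cube p l. ennreal \<bar>heat_ext t x\<bar> \<partial>lebesgue) \<le> ennreal (a * l ^ CARD('n))"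
      unfolding nn_integral_completion by (rule heat_ext_large_cube[OF t l])
  qed (use a_nonneg in auto)
  then show ?thesis by simp
qed

lemma partial_heat_ext: "0 < t \<Longrightarrow> partial i (heat_ext t) = convolve (heat_kernel_d i) v t"
  unfolding partial_def by (intro ext DERIV_imp_deriv heat_ext_partial)

lemma partial2_heat_ext: "0 < t \<Longrightarrow> partial i (partial j (heat_ext t)) = convolve (heat_kernel_d2 i j) v t"
  unfolding partial_heat_ext by (unfold partial_def) (intro ext DERIV_imp_deriv heat_ext_partial2)

text \<open>At time 0 the value is \<open>u0\<close> itself and not its representative
  \<open>v\<close>, since \<open>heat_solution\<close> demands equality of functions there.\<close>

definition solution :: "(real ^ 'n \<Rightarrow> real) \<Rightarrow> real \<Rightarrow> real ^ 'n \<Rightarrow> real" where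
  "solution u0 t = (if 0 < t then heat_ext t else u0)"

lemma solution_time_deriv:
  assumes t: "0 < t"
  shows "((\<lambda>s. solution u0 s x) has_real_derivative convolve heat_kernel_dt v t x) (at t)"
  by (rule has_field_derivative_transform_within_open[OF heat_ext_time[OF t], of "{0<..}"])
    (use t in \<open>auto simp: solution_def\<close>)

lemma time_deriv_solution: "0 < t \<Longrightarrow> time_deriv (solution u0) t x = convolve heat_kernel_dt v t x"
  unfolding time_deriv_def by (intro DERIV_imp_deriv solution_time_deriv)

lemma C12_solution: "C12 (solution u0)"
  unfolding C12_def
proof (intro conjI allI impI)
  fix t :: real and x i j assume t: "0 < t"
  show "(\<lambda>s. solution u0 s x) differentiable at t"
    using solution_time_deriv[OF t] by (auto simp: real_differentiable_def)
  show "has_partial i (solution u0 t) x"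
    unfolding has_partial_def solution_def using t heat_ext_partial[OF t]
    by (auto simp: real_differentiable_def)
  show "has_partial i (partial j (solution u0 t)) x"
    unfolding has_partial_def solution_def using t heat_ext_partial2[OF t]
    by (auto simp: partial_heat_ext real_differentiable_def)
next
  show "continuous_on ({0<..} \<times> UNIV) (\<lambda>(t, x). solution u0 t x)"
    by (rule continuous_on_cong[THEN iffD1, OF refl _ convolve_continuous[OF admissible_heat_kernel]])
      (auto simp: solution_def heat_ext_def)
  show "continuous_on ({0<..} \<times> UNIV) (\<lambda>(t, x). time_deriv (solution u0) t x)"
    by (rule continuous_on_cong[THEN iffD1, OF refl _ convolve_continuous[OF admissible_heat_kernel_dt]])
      (auto simp: time_deriv_solution)
  fix i j
  show "continuous_on ({0<..} \<times> UNIV) (\<lambda>(t, x). partial i (solution u0 t) x)"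
    by (rule continuous_on_cong[THEN iffD1, OF refl _ convolve_continuous[OF admissible_heat_kernel_d]])
      (auto simp: solution_def partial_heat_ext)
  show "continuous_on ({0<..} \<times> UNIV) (\<lambda>(t, x). partial i (partial j (solution u0 t)) x)"
    by (rule continuous_on_cong[THEN iffD1, OF refl _ convolve_continuous[OF admissible_heat_kernel_d2]])
      (auto simp: solution_def partial2_heat_ext)
qed

lemma heat_solution_solution:
  assumes ae: "AE x in lborel. u0 x = v x"
  shows "heat_solution u0 (solution u0)"
  unfolding heat_solution_def
proof (intro conjI allI impI)
  fix t :: real and x assume t: "0 < t"
  show "time_deriv (solution u0) t x - laplacian (solution u0 t) x = 0"
    using t by (simp add: time_deriv_solution laplacian_def solution_def partial2_heat_ext convolve_dt)
next
  fix K :: "(real ^ 'n) set" assume K: "compact K"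
  have "eventually (\<lambda>t. (\<integral>\<^sup>+x\<in>K. ennreal \<bar>heat_ext t x - v x\<bar> \<partial>lborel)
      = (\<integral>\<^sup>+x\<in>K. ennreal \<bar>solution u0 t x - solution u0 0 x\<bar> \<partial>lebesgue)) (at_right 0)"
    using eventually_at_right_less[of 0]
  proof eventually_elim
    case (elim t)
    then show ?case
      unfolding nn_integral_completion using ae by (intro nn_integral_cong_AE) (auto simp: solution_def)
  qed
  with heat_ext_initial[OF K]
  show "((\<lambda>t. \<integral>\<^sup>+x\<in>K. ennreal \<bar>solution u0 t x - solution u0 0 x\<bar> \<partial>lebesgue) \<longlongrightarrow> 0) (at_right 0)"
    by (rule Lim_transform_eventually)
qed (simp_all add: C12_solution, simp add: solution_def)

text \<open>The Euclidean norm is at most the sum of the absolute values of the components, hence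
  the factor \<open>CARD('n)\<close>.\<close>

lemma grad_solution_bound:
  assumes t: "0 < t"
  shows "ennreal (sqrt t) * Linf_norm (grad (solution u0 t))
    \<le> ennreal (real CARD('n) * (fact (1 + (2 * CARD('n) + 2)) * exp 2 * 3 * 2 ^ CARD('n) * weight_sum * a))"
proof (rule scaled_Linf_norm_le)
  have g: "grad (solution u0 t) = (\<lambda>x. \<chi> i. convolve (heat_kernel_d i) v t x)"
    using t by (intro ext) (simp add: grad_def solution_def partial_heat_ext)
  show "continuous_on UNIV (grad (solution u0 t))"
    unfolding g
    by (intro continuous_on_vec_lambda continuous_on_slice[OF convolve_continuous[OF admissible_heat_kernel_d] t])
  fix x
  have "sqrt t * norm (grad (solution u0 t) x) \<le> sqrt t * (\<Sum>i\<in>UNIV. \<bar>convolve (heat_kernel_d i) v t x\<bar>)"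
    using norm_le_l1_cart[of "grad (solution u0 t) x"] t unfolding g by (intro mult_left_mono) auto
  also have "\<dots> = (\<Sum>i\<in>UNIV. sqrt t * \<bar>convolve (heat_kernel_d i) v t x\<bar>)"
    by (rule sum_distrib_left)
  also have "\<dots> \<le> (\<Sum>i\<in>(UNIV :: 'n set). fact (1 + (2 * CARD('n) + 2)) * exp 2 * 3 * 2 ^ CARD('n) * weight_sum * a)"
    by (intro sum_mono convolve_d_bound t)
  finally show "sqrt t * norm (grad (solution u0 t) x)
      \<le> real CARD('n) * (fact (1 + (2 * CARD('n) + 2)) * exp 2 * 3 * 2 ^ CARD('n) * weight_sum * a)"
    by simp
qed (use t in simp)

lemma hessian_solution_bound:
  assumes t: "0 < t"
  shows "ennreal t * Linf_norm (hessian (solution u0 t))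
    \<le> ennreal (real CARD('n) * (real CARD('n) * (fact (2 + (2 * CARD('n) + 2)) * exp 2 * 3 * 2 ^ CARD('n) * weight_sum * a)))"
proof (rule scaled_Linf_norm_le)
  have h: "hessian (solution u0 t) = (\<lambda>x. \<chi> i j. convolve (heat_kernel_d2 i j) v t x)"
    using t by (intro ext) (simp add: hessian_def solution_def partial2_heat_ext)
  show "continuous_on UNIV (hessian (solution u0 t))"
    unfolding h
    by (intro continuous_on_vec_lambda continuous_on_slice[OF convolve_continuous[OF admissible_heat_kernel_d2] t])
  fix x
  have "norm (hessian (solution u0 t) x) \<le> (\<Sum>i\<in>UNIV. norm (hessian (solution u0 t) x $ i))"
    unfolding norm_vec_def by (rule L2_set_le_sum) simp
  also have "\<dots> \<le> (\<Sum>i\<in>UNIV. \<Sum>j\<in>UNIV. \<bar>hessian (solution u0 t) x $ i $ j\<bar>)"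
    by (intro sum_mono norm_le_l1_cart)
  finally have "t * norm (hessian (solution u0 t) x) \<le> t * (\<Sum>i\<in>UNIV. \<Sum>j\<in>UNIV. \<bar>hessian (solution u0 t) x $ i $ j\<bar>)"
    using t by (intro mult_left_mono) auto
  also have "\<dots> = (\<Sum>i\<in>UNIV. \<Sum>j\<in>UNIV. t * \<bar>convolve (heat_kernel_d2 i j) v t x\<bar>)"
    by (simp add: sum_distrib_left h)
  also have "\<dots> \<le> (\<Sum>i\<in>(UNIV :: 'n set). \<Sum>j\<in>(UNIV :: 'n set). fact (2 + (2 * CARD('n) + 2)) * exp 2 * 3 * 2 ^ CARD('n) * weight_sum * a)"
    by (intro sum_mono convolve_d2_bound t)
  finally show "t * norm (hessian (solution u0 t) x)
      \<le> real CARD('n) * (real CARD('n) * (fact (2 + (2 * CARD('n) + 2)) * exp 2 * 3 * 2 ^ CARD('n) * weight_sum * a))"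
    by simp
qed (rule t)

text \<open>The time derivative is the trace of the Hessian, so only the \<open>CARD('n)\<close>
  diagonal entries enter.\<close>

lemma time_deriv_solution_bound:
  assumes t: "0 < t"
  shows "ennreal t * Linf_norm (time_deriv (solution u0) t)
    \<le> ennreal (real CARD('n) * (fact (2 + (2 * CARD('n) + 2)) * exp 2 * 3 * 2 ^ CARD('n) * weight_sum * a))"
proof (rule scaled_Linf_norm_le)
  have d: "time_deriv (solution u0) t = convolve heat_kernel_dt v t"
    using t by (intro ext time_deriv_solution)
  show "continuous_on UNIV (time_deriv (solution u0) t)"
    unfolding d by (rule continuous_on_slice[OF convolve_continuous[OF admissible_heat_kernel_dt] t])
  fix x
  have "t * norm (time_deriv (solution u0) t x) \<le> t * (\<Sum>i\<in>UNIV. \<bar>convolve (heat_kernel_d2 i i) v t x\<bar>)"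
    unfolding d convolve_dt[OF t] real_norm_def using t by (intro mult_left_mono sum_abs) simp
  also have "\<dots> = (\<Sum>i\<in>UNIV. t * \<bar>convolve (heat_kernel_d2 i i) v t x\<bar>)"
    by (rule sum_distrib_left)
  also have "\<dots> \<le> (\<Sum>i\<in>(UNIV :: 'n set). fact (2 + (2 * CARD('n) + 2)) * exp 2 * 3 * 2 ^ CARD('n) * weight_sum * a)"
    by (intro sum_mono convolve_d2_bound t)
  finally show "t * norm (time_deriv (solution u0) t x)
      \<le> real CARD('n) * (fact (2 + (2 * CARD('n) + 2)) * exp 2 * 3 * 2 ^ CARD('n) * weight_sum * a)"
    by simp
qed (rule t)

end

theorem lemma2p5:
  "\<exists>C::real. 0 \<le> C \<and>
     (\<forall>u0 \<in> (bmo :: (real ^ 'n \<Rightarrow> real) set). \<exists>u. heat_solution u0 u \<and>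
       (SUP t\<in>{0<..}.
          bmo_norm (u t)
          + ennreal (sqrt t) * Linf_norm (grad (u t))
          + ennreal t * Linf_norm (hessian (u t))
          + ennreal t * Linf_norm (time_deriv u t))
       \<le> ennreal C * bmo_norm u0)"
proof -
  define c :: "nat \<Rightarrow> real"
    where "c m = fact (m + (2 * CARD('n) + 2)) * exp 2 * 3 * 2 ^ CARD('n) * weight_sum" for m
  define n where "n = real CARD('n)"
  have c0: "0 \<le> c m" for m
    using weight_sum_nonneg by (simp add: c_def)
  have n0: "0 \<le> n"
    by (simp add: n_def)
  \<comment> \<open>The summands match the four terms of the supremum: bmo norm, gradient, Hessian
    with its \<open>n * n\<close> entries, and time derivative. The argument of \<open>c\<close> is
    the order of the space derivatives.\<close>
  define C where "C = 5 + n * c 1 + n * (n * c 2) + n * c 2"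
  have C0: "0 \<le> C"
    using c0 n0 by (simp add: C_def)
  show ?thesis
  proof (rule exI[of _ C], intro conjI ballI)
    fix u0 :: "real ^ 'n \<Rightarrow> real" assume u0: "u0 \<in> bmo"
    define a where "a = enn2real (bmo_norm u0)"
    have a: "bmo_norm u0 = ennreal a" "0 \<le> a"
      using u0 by (auto simp: a_def bmo_def)
    obtain v where ae: "AE x in lborel. u0 x = v x" and "bmo_function v a"
      using bmo_borel_representative[OF u0] unfolding a_def by blast
    then interpret bmo_function v a by simp
    have "(SUP t\<in>{0<..}. bmo_norm (solution u0 t)
          + ennreal (sqrt t) * Linf_norm (grad (solution u0 t))
          + ennreal t * Linf_norm (hessian (solution u0 t))
          + ennreal t * Linf_norm (time_deriv (solution u0) t)) \<le> ennreal C * bmo_norm u0"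
    proof (rule SUP_least)
      fix t :: real assume "t \<in> {0<..}"
      then have t: "0 < t" by simp
      have "bmo_norm (solution u0 t) + ennreal (sqrt t) * Linf_norm (grad (solution u0 t))
          + ennreal t * Linf_norm (hessian (solution u0 t)) + ennreal t * Linf_norm (time_deriv (solution u0) t)
        \<le> ennreal (5 * a) + ennreal (n * (c 1 * a)) + ennreal (n * (n * (c 2 * a))) + ennreal (n * (c 2 * a))"
        using bmo_norm_heat_ext[OF t] grad_solution_bound[OF t, of u0] hessian_solution_bound[OF t, of u0]
          time_deriv_solution_bound[OF t, of u0] t
        unfolding c_def n_def by (intro add_mono) (simp_all only: solution_def if_True)
      also have "\<dots> = ennreal (5 * a + n * (c 1 * a) + n * (n * (c 2 * a)) + n * (c 2 * a))"
        using c0 n0 a(2) by simp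
      also have "5 * a + n * (c 1 * a) + n * (n * (c 2 * a)) + n * (c 2 * a) = C * a"
        by (simp add: C_def algebra_simps)
      also have "ennreal (C * a) = ennreal C * bmo_norm u0"
        using C0 a by (simp add: ennreal_mult)
      finally show "bmo_norm (solution u0 t) + ennreal (sqrt t) * Linf_norm (grad (solution u0 t))
          + ennreal t * Linf_norm (hessian (solution u0 t)) + ennreal t * Linf_norm (time_deriv (solution u0) t)
        \<le> ennreal C * bmo_norm u0" .
    qed
    with heat_solution_solution[OF ae]
    show "\<exists>u. heat_solution u0 u \<and>
       (SUP t\<in>{0<..}.
          bmo_norm (u t)
          + ennreal (sqrt t) * Linf_norm (grad (u t))
          + ennreal t * Linf_norm (hessian (u t))
          + ennreal t * Linf_norm (time_deriv u t))
       \<le> ennreal C * bmo_norm u0"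
      by blast
  qed (rule C0)
qed

end
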